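(* For every integer $n\geq 2$, one has \[ \chi\left(R_n/I_n\right) = [1] + \frac{n-2}{2}\,[\mathcal{P}(n)] \in \mathrm{Rep}(S_n), \] where for $n$ odd the right-hand side is understood as $[1]+(n-2)\cdot\frac{1}{2}[\mathcal{P}(n)]$, with $\frac{1}{2}[\mathcal{P}(n)]\in\mathrm{Rep}(S_n)$ the class of the permutation representation on the even-element subsets of $\{1,\ldots,n\}$.
   Context: $F$ is an algebraically closed field of characteristic $0$, and $R_n=F[x_1,\ldots,x_n]$. For $n\geq 3$, $I_n\lhd R_n$ is the ideal generated by the $n$ polynomials $\left(\prod_{j\neq i}x_j\right)-x_i$, $1\leq i\leq n$; for $n=2$ one sets $I_2=\langle x_1,x_2\rangle\lhd F[x_1,x_2]$. The symmetric group $S_n$ acts on $R_n$ by permuting the variables; $I_n$ is $S_n$-invariant, and the quotient $R_n/I_n$ is a finite-dimensional $F$-vector space, so it is a finite-dimensional $S_n$-representation. $\mathrm{Rep}(S_n)$ denotes the ring of finite-dimensional representations of $S_n$ over $F$ (representation ring), with unit $[1]$ (the class of the trivial representation). For a finite-dimensional $S_n$-representation $V$, $\chi(V)\in\mathrm{Rep}(S_n)$ is the corresponding ring element. $\mathcal{P}(n)$ is the set of all subsets of $\{1,\ldots,n\}$ and $[\mathcal{P}(n)]\in\mathrm{Rep}(S_n)$ is the class of the corresponding permutation representation, of dimension $2^n$. If $n$ is odd, the permutation representations on the set of even-element subsets and on the set of odd-element subsets of $\{1,\ldots,n\}$ are isomorphic; $\frac12[\mathcal{P}(n)]\in\mathrm{Rep}(S_n)$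 denotes their common class, of dimension $2^{n-1}$. *)

theory Defs
  imports
    "HOL-Library.Poly_Mapping"
    "HOL-Computational_Algebra.Polynomial"
    "HOL-Algebra.QuotRing"
    "HOL-Algebra.Generated_Groups"
    "HOL-Algebra.Sym_Groups"
    "Jordan_Normal_Form.VS_Connect"
begin

text \<open>
  A representation of \<open>G\<close> over a field \<open>'a\<close> is a vector space \<open>V\<close> together with a map
  \<open>\<rho>\<close> sending a group element to an operator on \<open>V\<close>.
  Note that the locale \<^locale>\<open>linear_map\<close> includes the vector space axioms for both sides.
\<close>

definition rep_iso ::
  "('g, 'm) monoid_scheme \<Rightarrow> ('a::field, 'v) module \<Rightarrow> ('g \<Rightarrow> 'v \<Rightarrow> 'v)
    \<Rightarrow> ('a, 'w) module \<Rightarrow> ('g \<Rightarrow> 'w \<Rightarrow> 'w) \<Rightarrow> bool"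
  where "rep_iso G V \<rho> W \<sigma> \<longleftrightarrow>
    (\<exists>T. linear_map class_ring V W T \<and> bij_betw T (carrier V) (carrier W) \<and>
         (\<forall>g\<in>carrier G. \<forall>v\<in>carrier V. T (\<rho> g v) = \<sigma> g (T v)))"

text \<open>Matrix representations, that is, homomorphisms from \<open>G\<close> to \<open>GL\<^sub>d(F)\<close> with \<open>d \<ge> 0\<close>.\<close>

definition GL :: "'a::field itself \<Rightarrow> nat \<Rightarrow> 'a mat monoid"
  where "GL F d = units_of (ring_mat F d ())"

definition mat_reps :: "('g, 'm) monoid_scheme \<Rightarrow> ('g \<Rightarrow> 'a::field mat) set"
  where "mat_reps G = (\<Union>d. hom G (GL TYPE('a) d))"

definition mat_deg :: "('g, 'm) monoid_scheme \<Rightarrow> ('g \<Rightarrow> 'a mat) \<Rightarrow> nat"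
  where "mat_deg G M = dim_row (M \<one>\<^bsub>G\<^esub>)"

definition mat_space :: "('g, 'm) monoid_scheme \<Rightarrow> ('g \<Rightarrow> 'a::field mat) \<Rightarrow> ('a, 'a vec) module"
  where "mat_space G M = module_vec TYPE('a) (mat_deg G M)"

definition mat_act :: "('g \<Rightarrow> 'a::field mat) \<Rightarrow> 'g \<Rightarrow> 'a vec \<Rightarrow> 'a vec"
  where "mat_act M g v = M g *\<^sub>v v"

definition rep_sum :: "('g \<Rightarrow> 'a::field mat) \<Rightarrow> ('g \<Rightarrow> 'a mat) \<Rightarrow> 'g \<Rightarrow> 'a mat"
  where "rep_sum M N g = diag_block_mat [M g, N g]"

definition kronecker :: "'a::field mat \<Rightarrow> 'a mat \<Rightarrow> 'a mat"
  where "kronecker A B =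
    mat (dim_row A * dim_row B) (dim_col A * dim_col B)
      (\<lambda>(i, j). A $$ (i div dim_row B, j div dim_col B) * B $$ (i mod dim_row B, j mod dim_col B))"

definition rep_tensor :: "('g \<Rightarrow> 'a::field mat) \<Rightarrow> ('g \<Rightarrow> 'a mat) \<Rightarrow> 'g \<Rightarrow> 'a mat"
  where "rep_tensor M N g = kronecker (M g) (N g)"

definition trivial_rep :: "'g \<Rightarrow> 'a::field mat"
  where "trivial_rep g = 1\<^sub>m 1"

text \<open>
  \<open>Rep(G)\<close> is the free abelian group on the finite-dimensional representations, modulo the
  subgroup generated by the relations \<open>[M] = [N]\<close> for \<open>M \<cong> N\<close> and \<open>[M \<oplus> N] = [M] + [N]\<close>;
  the product is induced by the tensor product.  Every finite-dimensional representation is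
  isomorphic to a matrix representation, so matrix representations suffice as generators.
\<close>

definition free_rep_ring ::
  "'a::field itself \<Rightarrow> ('g, 'm) monoid_scheme \<Rightarrow> (('g \<Rightarrow> 'a mat) \<Rightarrow>\<^sub>0 int) ring"
  where "free_rep_ring F G =
    \<lparr> carrier = {c. Poly_Mapping.keys c \<subseteq> mat_reps G},
      monoid.mult = (\<lambda>x y. frag_extend (\<lambda>M. frag_extend (\<lambda>N. frag_of (rep_tensor M N)) y) x),
      one = frag_of trivial_rep, zero = 0, add = (+) \<rparr>"

definition rep_relations ::
  "'a::field itself \<Rightarrow> ('g, 'm) monoid_scheme \<Rightarrow> (('g \<Rightarrow> 'a mat) \<Rightarrow>\<^sub>0 int) set"
  where "rep_relations F G =
    {frag_of M - frag_of N | M N. M \<in> mat_reps G \<and> N \<in> mat_reps G \<and>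
        rep_iso G (mat_space G M) (mat_act M) (mat_space G N) (mat_act N)} \<union>
    {frag_of (rep_sum M N) - (frag_of M + frag_of N) | M N. M \<in> mat_reps G \<and> N \<in> mat_reps G}"

definition rep_ideal ::
  "'a::field itself \<Rightarrow> ('g, 'm) monoid_scheme \<Rightarrow> (('g \<Rightarrow> 'a mat) \<Rightarrow>\<^sub>0 int) set"
  where "rep_ideal F G = generate (add_monoid (free_rep_ring F G)) (rep_relations F G)"

definition rep_ring ::
  "'a::field itself \<Rightarrow> ('g, 'm) monoid_scheme \<Rightarrow> (('g \<Rightarrow> 'a mat) \<Rightarrow>\<^sub>0 int) set ring"
  where "rep_ring F G = free_rep_ring F G Quot rep_ideal F G"

text \<open>
  The class of \<open>(V, \<rho>)\<close> is the common coset of all matrix representations isomorphic to it.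
  If \<open>(V, \<rho>)\<close> is not a finite-dimensional representation, the union is empty and hence
  not an element of the representation ring.
\<close>

definition rep_class ::
  "('g, 'm) monoid_scheme \<Rightarrow> ('a::field, 'v) module \<Rightarrow> ('g \<Rightarrow> 'v \<Rightarrow> 'v)
    \<Rightarrow> (('g \<Rightarrow> 'a mat) \<Rightarrow>\<^sub>0 int) set"
  where "rep_class G V \<rho> =
    (\<Union>M \<in> {M \<in> mat_reps G. rep_iso G (mat_space G M) (mat_act M) V \<rho>}.
       rep_ideal TYPE('a) G +>\<^bsub>free_rep_ring TYPE('a) G\<^esub> frag_of M)"

text \<open>Formal linear combinations of elements of a finite set \<open>X\<close>, on which \<open>g\<close> acts by \<open>x \<mapsto> \<phi> g x\<close>.\<close>

definition perm_space :: "'a::field itself \<Rightarrow> 'x set \<Rightarrow> ('a, 'x \<Rightarrow>\<^sub>0 'a) module"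
  where "perm_space F X =
    \<lparr> carrier = {f. Poly_Mapping.keys f \<subseteq> X}, monoid.mult = undefined, one = undefined,
      zero = 0, add = (+), smult = (\<lambda>c. Poly_Mapping.map ((*) c)) \<rparr>"

definition perm_act :: "('g \<Rightarrow> 'x \<Rightarrow> 'x) \<Rightarrow> 'g \<Rightarrow> ('x \<Rightarrow>\<^sub>0 'a::field) \<Rightarrow> ('x \<Rightarrow>\<^sub>0 'a)"
  where "perm_act \<phi> g f =
    (\<Sum>x\<in>Poly_Mapping.keys f. Poly_Mapping.single (\<phi> g x) (Poly_Mapping.lookup f x))"

definition perm_class ::
  "'a::field itself \<Rightarrow> ('g, 'm) monoid_scheme \<Rightarrow> 'x set \<Rightarrow> ('g \<Rightarrow> 'x \<Rightarrow> 'x)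
    \<Rightarrow> (('g \<Rightarrow> 'a mat) \<Rightarrow>\<^sub>0 int) set"
  where "perm_class F G X \<phi> = rep_class G (perm_space F X) (perm_act \<phi>)"

text \<open>
  A polynomial maps an exponent vector (\<open>nat \<Rightarrow>\<^sub>0 nat\<close>, from indices of variables to exponents)
  to its coefficient.
\<close>

type_synonym 'a mpoly = "(nat \<Rightarrow>\<^sub>0 nat) \<Rightarrow>\<^sub>0 'a"

definition Const :: "'a::field \<Rightarrow> 'a mpoly"
  where "Const c = Poly_Mapping.single 0 c"

definition Var :: "nat \<Rightarrow> 'a::field mpoly"
  where "Var i = Poly_Mapping.single (Poly_Mapping.single i 1) 1"

definition poly_ring :: "'a::field itself \<Rightarrow> nat \<Rightarrow> 'a mpoly ring"
  where "poly_ring F n =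
    \<lparr> carrier = {p. \<forall>m\<in>Poly_Mapping.keys p. Poly_Mapping.keys m \<subseteq> {1..n}},
      monoid.mult = (*), one = 1, zero = 0, add = (+) \<rparr>"

definition I_gens :: "'a::field itself \<Rightarrow> nat \<Rightarrow> 'a mpoly set"
  where "I_gens F n =
    (if n = 2 then {Var 1, Var 2}
     else {(\<Prod>j\<in>{1..n} - {i}. Var j) - Var i | i. i \<in> {1..n}})"

definition I_ideal :: "'a::field itself \<Rightarrow> nat \<Rightarrow> 'a mpoly set"
  where "I_ideal F n = genideal (poly_ring F n) (I_gens F n)"

definition quot_space :: "'a::field itself \<Rightarrow> nat \<Rightarrow> ('a, 'a mpoly set) module"
  where "quot_space F n =
    (let R = poly_ring F n; Q = R Quot I_ideal F n
     in \<lparr> carrier = carrier Q, monoid.mult = monoid.mult Q, one = one Q, zero = zero Q, add = add Q,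
          smult = (\<lambda>c X. (I_ideal F n +>\<^bsub>R\<^esub> Const c) \<otimes>\<^bsub>Q\<^esub> X) \<rparr>)"

text \<open>
  \<open>S\<^sub>n\<close> acts by substituting \<open>x\<^bsub>\<sigma>(i)\<^esub>\<close> for \<open>x\<^sub>i\<close>; see \<open>poly_act_Var\<close> below.  The coefficient of
  \<open>\<sigma> p\<close> at an exponent vector \<open>m\<close> is that of \<open>p\<close> at \<open>m \<circ> \<sigma>\<close>, and
  \<open>Poly_Mapping.map_key \<sigma> m\<close> is \<open>m \<circ> \<sigma>\<close> for injective \<open>\<sigma>\<close>.
\<close>

definition poly_act :: "(nat \<Rightarrow> nat) \<Rightarrow> 'a::field mpoly \<Rightarrow> 'a mpoly"
  where "poly_act \<sigma> = Poly_Mapping.map_key (Poly_Mapping.map_key \<sigma>)"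

text \<open>A coset is mapped to its image, \<open>\<sigma> (p + I\<^sub>n) = \<sigma> p + I\<^sub>n\<close>, as \<open>I\<^sub>n\<close> is invariant.\<close>

definition quot_act :: "(nat \<Rightarrow> nat) \<Rightarrow> 'a::field mpoly set \<Rightarrow> 'a mpoly set"
  where "quot_act \<sigma> X = poly_act \<sigma> ` X"

definition even_subsets :: "nat \<Rightarrow> nat set set"
  where "even_subsets n = {A \<in> Pow {1..n}. even (card A)}"

lemma poly_ring_cring: "cring (poly_ring F n)"
proof (rule cringI)
  show "abelian_group (poly_ring F n)"
  proof (rule abelian_groupI)
    fix x assume "x \<in> carrier (poly_ring F n)"
    then show "\<exists>y\<in>carrier (poly_ring F n). y \<oplus>\<^bsub>poly_ring F n\<^esub> x = \<zero>\<^bsub>poly_ring F n\<^esub>"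
      by (intro bexI[of _ "- x"]) (auto simp: poly_ring_def)
  qed (auto simp: poly_ring_def algebra_simps dest!: subsetD[OF Poly_Mapping.keys_add])
  show "comm_monoid (poly_ring F n)"
  proof (rule comm_monoidI)
    fix x y assume xy: "x \<in> carrier (poly_ring F n)" "y \<in> carrier (poly_ring F n)"
    show "x \<otimes>\<^bsub>poly_ring F n\<^esub> y \<in> carrier (poly_ring F n)"
    proof -
      have "Poly_Mapping.keys m \<subseteq> {1..n}" if m: "m \<in> Poly_Mapping.keys (x * y)" for m
      proof -
        obtain a b where "m = a + b" "a \<in> Poly_Mapping.keys x" "b \<in> Poly_Mapping.keys y"
          using subsetD[OF keys_mult m] by auto
        then show ?thesis
          using xy Poly_Mapping.keys_add[of a b] unfolding poly_ring_def by simp blast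
      qed
      then show ?thesis by (auto simp: poly_ring_def)
    qed
  qed (auto simp: poly_ring_def algebra_simps)
qed (auto simp: poly_ring_def algebra_simps)

lemma inj_map_key:
  assumes "bij \<sigma>"
  shows "inj (Poly_Mapping.map_key \<sigma> :: (nat \<Rightarrow>\<^sub>0 nat) \<Rightarrow> _)"
proof (rule injI)
  fix a b :: "nat \<Rightarrow>\<^sub>0 nat"
  assume "Poly_Mapping.map_key \<sigma> a = Poly_Mapping.map_key \<sigma> b"
  then have "Poly_Mapping.lookup a (\<sigma> i) = Poly_Mapping.lookup b (\<sigma> i)" for i
    using assms by (metis bij_is_inj comp_apply map_key.rep_eq)
  then show "a = b"
    by (intro poly_mapping_eqI) (metis assms bij_pointE)
qed

lemma poly_act_Var:
  assumes "bij \<sigma>"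
  shows "poly_act \<sigma> (Var i) = Var (\<sigma> i)"
proof -
  have "Poly_Mapping.single i (1::nat) =
      Poly_Mapping.map_key \<sigma> (Poly_Mapping.single (\<sigma> i) 1)"
    using assms by (simp add: bij_is_inj)
  then show ?thesis
    unfolding poly_act_def Var_def
    using map_key_single[OF inj_map_key[OF assms]] by metis
qed

end

theory Submission
  imports Defs "Jordan_Normal_Form.Char_Poly"
begin

text \<open>
  The zeros of \<open>I\<^sub>n\<close> are isolated and simple, so \<open>R\<^sub>n/I\<^sub>n\<close> is the algebra of functions on a finite
  \<open>S\<^sub>n\<close>-set, that is, a permutation representation, and the theorem is a description of this set.

  Simplicity of the zeros is made elementary as follows.  Let \<open>n \<ge> 3\<close>.  Modulo \<open>I\<^sub>n\<close> all \<open>x\<^sub>i\<^sup>2\<close> are equal to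
  \<open>x\<^sub>1\<cdots>x\<^sub>n\<close>, and combining two of the generators gives \<open>x\<^sub>i\<^bsup>2n-3\<^esup> - x\<^sub>i \<in> I\<^sub>n\<close> (\<open>Var_power_in_ideal\<close>).
  In characteristic \<open>0\<close> the polynomial \<open>X\<^bsup>2n-3\<^esup> - X\<close> is separable; let \<open>Z\<close> be its set of roots.  If \<open>L\<^sub>z\<close>
  are the Lagrange polynomials of \<open>Z\<close>, then the products \<open>e\<^sub>a = L\<^bsub>a(1)\<^esub>(x\<^sub>1)\<cdots>L\<^bsub>a(n)\<^esub>(x\<^sub>n)\<close> for \<open>a \<in> Z\<^sup>n\<close> add up to
  \<open>1\<close>, and \<open>p e\<^sub>a \<equiv> p(a) e\<^sub>a\<close> modulo \<open>I\<^sub>n\<close> for every \<open>p\<close>.  A generator that does not vanish at \<open>a\<close> therefore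
  forces \<open>e\<^sub>a \<in> I\<^sub>n\<close>, and \<open>p \<equiv> \<Sum> p(a) e\<^sub>a\<close>, summed over the common zeros \<open>a\<close> of the generators.  Hence a
  polynomial lies in \<open>I\<^sub>n\<close> as soon as it vanishes at all zeros (\<open>in_ideal_iff_vanishes\<close>), and any values at the
  zeros can be prescribed (\<open>interpolation_on_zeros\<close>).  Sending a function on the zeros to the coset of its
  interpolants is the required isomorphism of representations (\<open>perm_space_zeros_iso_quot_space\<close>).  For
  \<open>n = 2\<close> the same argument applies with \<open>Z = {0}\<close>, and the origin is the only zero.

  A zero other than the origin has coordinates \<open>\<plusminus>t\<close> with \<open>t \<noteq> 0\<close>; if \<open>A\<close> is the set of the
  coordinates equal to \<open>-t\<close>, then the equations say \<open>t\<^bsup>n-2\<^esup> = (-1)\<^bsup>|A|\<^esup>\<close>.  The pairs \<open>(t, A)\<close> and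
  \<open>(-t, A\<^sup>c)\<close> give the same zero, and this ambiguity is removed by fixing a square root \<open>t = r(s)\<close> of each
  \<open>s = t\<^sup>2\<close> (\<open>nonzero_zeros_I_gens\<close>).  For odd \<open>n\<close> the square root can be chosen such that the pairs
  become \<open>(s, A)\<close> with \<open>s\<^bsup>n-2\<^esup> = 1\<close> and \<open>|A|\<close> even (\<open>nonzero_zeros_odd\<close>).  For even \<open>n\<close>
  the condition reads \<open>s\<^bsup>(n-2)/2\<^esup> = (-1)\<^bsup>|A|\<^esup>\<close>; rescaling \<open>s\<close> when \<open>|A|\<close> is odd turns it into
  \<open>s\<^bsup>(n-2)/2\<^esup> = 1\<close> with \<open>A\<close> arbitrary (\<open>nonzero_zeros_even\<close>).  As \<open>S\<^sub>n\<close> moves only \<open>A\<close> and fixes \<open>s\<close>, the set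
  of zeros is a fixed point together with copies of a set of subsets, one for each root of unity.

  In the representation ring, a finite \<open>G\<close>-set is represented by its permutation matrices with respect
  to an enumeration.  Concatenating enumerations is taking block diagonal matrices, so disjoint unions become
  sums (\<open>perm_class_disjoint_union\<close>).
\<close>

section \<open>Polynomials and their values\<close>

\<comment> \<open>Otherwise the simplifier turns the index set \<open>{1..n}\<close> into \<open>{Suc 0..n}\<close>.\<close>
declare One_nat_def [simp del]

lemma Const_simps:
  "Const 0 = 0" "Const 1 = 1" "Const (a + b) = Const a + Const b" "Const (a - b) = Const a - Const b"
  "Const (a * b) = Const a * Const b"
  by (simp_all add: Const_def single_add single_diff mult_single)

lemma Const_neg: "Const (- c) = - Const c"
  by (metis Const_simps(1,4) diff_0)

lemma single_eq_monomial:
  "Poly_Mapping.single m c = Const c * (\<Prod>i\<in>Poly_Mapping.keys m. Var i ^ Poly_Mapping.lookup m i)"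
proof -
  have pow: "(Var i :: 'a mpoly) ^ k = Poly_Mapping.single (Poly_Mapping.single i k) 1" for i k
    by (induction k) (simp_all add: Var_def mult_single single_add[symmetric] plus_1_eq_Suc)
  have prod: "(\<Prod>i\<in>A. Poly_Mapping.single (f i) (1 :: 'a)) = Poly_Mapping.single (\<Sum>i\<in>A. f i) 1"
    if "finite A" for A and f :: "nat \<Rightarrow> nat \<Rightarrow>\<^sub>0 nat"
    using that by induction (simp_all add: mult_single)
  have "m = (\<Sum>i\<in>Poly_Mapping.keys m. Poly_Mapping.single i (Poly_Mapping.lookup m i))"
    by (rule poly_mapping_eqI)
       (auto simp: lookup_sum lookup_single when_def in_keys_iff)
  then show ?thesis
    by (simp add: pow prod Const_def mult_single)
qed

lemma sum_single_keys:
  "(\<Sum>m\<in>Poly_Mapping.keys p. Poly_Mapping.single m (Poly_Mapping.lookup p m)) = p"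
  by (rule poly_mapping_eqI) (auto simp: lookup_sum lookup_single when_def in_keys_iff)

lemma poly_ring_simps [simp]:
  "add (poly_ring F n) = (+)" "monoid.mult (poly_ring F n) = (*)"
  "one (poly_ring F n) = 1" "zero (poly_ring F n) = 0"
  by (simp_all add: poly_ring_def)

lemma poly_ring_a_inv:
  assumes "x \<in> carrier (poly_ring F n)"
  shows "- x \<in> carrier (poly_ring F n)" "\<ominus>\<^bsub>poly_ring F n\<^esub> x = - x"
proof -
  interpret cring "poly_ring F n" by (rule poly_ring_cring)
  show x: "- x \<in> carrier (poly_ring F n)" using assms by (auto simp: poly_ring_def)
  show "\<ominus>\<^bsub>poly_ring F n\<^esub> x = - x"
    using assms x minus_equality[of "- x" x] by simp
qed

lemma poly_ring_closed [intro, simp]: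
  shows "p \<in> carrier (poly_ring F n) \<Longrightarrow> q \<in> carrier (poly_ring F n) \<Longrightarrow> p + q \<in> carrier (poly_ring F n)"
    and "p \<in> carrier (poly_ring F n) \<Longrightarrow> q \<in> carrier (poly_ring F n) \<Longrightarrow> p - q \<in> carrier (poly_ring F n)"
    and "p \<in> carrier (poly_ring F n) \<Longrightarrow> q \<in> carrier (poly_ring F n) \<Longrightarrow> p * q \<in> carrier (poly_ring F n)"
    and "0 \<in> carrier (poly_ring F n)" "1 \<in> carrier (poly_ring F n)"
    and "Const c \<in> carrier (poly_ring F n)"
    and "i \<in> {1..n} \<Longrightarrow> Var i \<in> carrier (poly_ring F n)"
proof -
  interpret cring "poly_ring F n" by (rule poly_ring_cring)
  show add: "p + q \<in> carrier (poly_ring F n)" if "p \<in> carrier (poly_ring F n)" "q \<in> carrier (poly_ring F n)" for p q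
    using a_closed[OF that] by simp
  show "p * q \<in> carrier (poly_ring F n)" if "p \<in> carrier (poly_ring F n)" "q \<in> carrier (poly_ring F n)"
    using m_closed[OF that] by simp
  show "p - q \<in> carrier (poly_ring F n)" if "p \<in> carrier (poly_ring F n)" "q \<in> carrier (poly_ring F n)"
    using add[OF that(1) poly_ring_a_inv(1)[OF that(2)]] by simp
  show "0 \<in> carrier (poly_ring F n)" "1 \<in> carrier (poly_ring F n)"
    using zero_closed one_closed by simp_all
qed (auto simp: poly_ring_def Const_def Var_def)

lemma poly_ring_sum_prod_closed [intro]:
  assumes "\<And>x. x \<in> A \<Longrightarrow> f x \<in> carrier (poly_ring F n)"
  shows "sum f A \<in> carrier (poly_ring F n)" "prod f A \<in> carrier (poly_ring F n)"
  using assms by (induction A rule: infinite_finite_induct) auto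

lemma poly_ring_power_closed [intro]:
  "p \<in> carrier (poly_ring F n) \<Longrightarrow> p ^ k \<in> carrier (poly_ring F n)"
  by (induction k) auto

lemma ideal_poly_ring_closed:
  assumes "ideal J (poly_ring F n)"
  shows "p \<in> J \<Longrightarrow> p \<in> carrier (poly_ring F n)" "p \<in> J \<Longrightarrow> q \<in> J \<Longrightarrow> p + q \<in> J" "0 \<in> J"
    and "p \<in> J \<Longrightarrow> q \<in> J \<Longrightarrow> p - q \<in> J" "p \<in> J \<Longrightarrow> q \<in> carrier (poly_ring F n) \<Longrightarrow> q * p \<in> J"
proof -
  interpret ideal J "poly_ring F n" by (rule assms)
  show add: "p + q \<in> J" if "p \<in> J" "q \<in> J" for p q using additive_subgroup.a_closed[OF ideal.axioms(1)[OF assms] that] by simp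
  show "p - q \<in> J" if "p \<in> J" "q \<in> J"
    using add[OF that(1) additive_subgroup.a_inv_closed[OF ideal.axioms(1)[OF assms] that(2)]]
      poly_ring_a_inv(2)[OF Icarr[OF that(2)]] by simp
  show "p \<in> J \<Longrightarrow> q \<in> carrier (poly_ring F n) \<Longrightarrow> q * p \<in> J" using I_l_closed by simp
qed (use assms ideal.Icarr additive_subgroup.zero_closed[OF ideal.axioms(1)[OF assms]] in auto)

text \<open>
  To prove that a congruence modulo an ideal holds for all polynomials, it suffices to treat constants and
  variables and to combine congruences.
\<close>

lemma poly_ring_induct [consumes 1, case_names Const Var add mult]:
  assumes p: "p \<in> carrier (poly_ring F n)"
    and Const: "\<And>c. P (Const c)" and Var: "\<And>i. i \<in> {1..n} \<Longrightarrow> P (Var i)"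
    and add: "\<And>p q. p \<in> carrier (poly_ring F n) \<Longrightarrow> q \<in> carrier (poly_ring F n) \<Longrightarrow> P p \<Longrightarrow> P q \<Longrightarrow> P (p + q)"
    and mult: "\<And>p q. p \<in> carrier (poly_ring F n) \<Longrightarrow> q \<in> carrier (poly_ring F n) \<Longrightarrow> P p \<Longrightarrow> P q \<Longrightarrow> P (p * q)"
  shows "P p"
proof -
  let ?C = "carrier (poly_ring F n)"
  have pow: "Var i ^ k \<in> ?C \<and> P (Var i ^ k)" if "i \<in> {1..n}" for i k
    using that Const[of 1] by (induction k) (auto intro!: mult Var simp: Const_simps)
  have prod: "prod f A \<in> ?C \<and> P (prod f A)"
    if "finite A" "\<And>i. i \<in> A \<Longrightarrow> f i \<in> ?C \<and> P (f i)" for A :: "nat set" and f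
    using that Const[of 1] by (induction A rule: finite_induct) (auto intro!: mult simp: Const_simps)
  have sum: "sum f A \<in> ?C \<and> P (sum f A)"
    if "finite A" "\<And>i. i \<in> A \<Longrightarrow> f i \<in> ?C \<and> P (f i)" for A :: "(nat \<Rightarrow>\<^sub>0 nat) set" and f
    using that Const[of 0] by (induction A rule: finite_induct) (auto intro!: add simp: Const_simps)
  have mon: "Poly_Mapping.single m c \<in> ?C \<and> P (Poly_Mapping.single m c)"
    if "Poly_Mapping.keys m \<subseteq> {1..n}" for m c
  proof -
    have "(\<Prod>i\<in>Poly_Mapping.keys m. Var i ^ Poly_Mapping.lookup m i) \<in> ?C
        \<and> P (\<Prod>i\<in>Poly_Mapping.keys m. Var i ^ Poly_Mapping.lookup m i)"
      using that by (intro prod pow) auto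
    then show ?thesis
      unfolding single_eq_monomial by (auto intro!: mult Const)
  qed
  have "(\<Sum>m\<in>Poly_Mapping.keys p. Poly_Mapping.single m (Poly_Mapping.lookup p m)) \<in> ?C \<and>
      P (\<Sum>m\<in>Poly_Mapping.keys p. Poly_Mapping.single m (Poly_Mapping.lookup p m))"
    using p by (intro sum mon) (auto simp: poly_ring_def)
  then show ?thesis by (simp add: sum_single_keys)
qed

definition monomial_eval :: "(nat \<Rightarrow> 'a::field) \<Rightarrow> (nat \<Rightarrow>\<^sub>0 nat) \<Rightarrow> 'a"
  where "monomial_eval a m = (\<Prod>i\<in>Poly_Mapping.keys m. a i ^ Poly_Mapping.lookup m i)"

definition eval :: "(nat \<Rightarrow> 'a::field) \<Rightarrow> 'a mpoly \<Rightarrow> 'a"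
  where "eval a p = (\<Sum>m\<in>Poly_Mapping.keys p. Poly_Mapping.lookup p m * monomial_eval a m)"

lemma monomial_eval_superset:
  assumes "finite S" "Poly_Mapping.keys m \<subseteq> S"
  shows "monomial_eval a m = (\<Prod>i\<in>S. a i ^ Poly_Mapping.lookup m i)"
  unfolding monomial_eval_def using assms
  by (intro prod.mono_neutral_left) (auto simp: in_keys_iff)

lemma monomial_eval_add: "monomial_eval a (m + m') = monomial_eval a m * monomial_eval a m'"
proof -
  let ?S = "Poly_Mapping.keys m \<union> Poly_Mapping.keys m'"
  have "monomial_eval a k = (\<Prod>i\<in>?S. a i ^ Poly_Mapping.lookup k i)" if "k \<in> {m, m', m + m'}" for k
    using that Poly_Mapping.keys_add[of m m'] by (intro monomial_eval_superset) auto
  then show ?thesis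
    by (simp add: lookup_add power_add prod.distrib)
qed

lemma eval_superset:
  assumes "finite S" "Poly_Mapping.keys p \<subseteq> S"
  shows "eval a p = (\<Sum>m\<in>S. Poly_Mapping.lookup p m * monomial_eval a m)"
  unfolding eval_def using assms
  by (intro sum.mono_neutral_left) (auto simp: in_keys_iff)

lemma eval_add: "eval a (p + q) = eval a p + eval a q"
proof -
  let ?S = "Poly_Mapping.keys p \<union> Poly_Mapping.keys q"
  have "eval a r = (\<Sum>m\<in>?S. Poly_Mapping.lookup r m * monomial_eval a m)" if "r \<in> {p, q, p + q}" for r
    using that Poly_Mapping.keys_add[of p q] by (intro eval_superset) auto
  then show ?thesis
    by (simp add: lookup_add algebra_simps sum.distrib)
qed

lemma eval_0 [simp]: "eval a 0 = 0"
  by (simp add: eval_def)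

lemma eval_uminus: "eval a (- p) = - eval a p"
  using eval_add[of a p "- p"] by (simp add: eq_neg_iff_add_eq_0 add.commute)

lemma eval_diff: "eval a (p - q) = eval a p - eval a q"
  using eval_add[of a p "- q"] by (simp add: eval_uminus)

lemma eval_sum: "eval a (sum f A) = (\<Sum>x\<in>A. eval a (f x))"
  by (induction A rule: infinite_finite_induct) (auto simp: eval_add)

lemma eval_single: "eval a (Poly_Mapping.single m c) = c * monomial_eval a m"
  using eval_superset[of "{m}" "Poly_Mapping.single m c" a] by simp

lemma eval_mult: "eval a (p * q) = eval a p * eval a q"
proof -
  have "eval a (p * q) = eval a ((\<Sum>m\<in>Poly_Mapping.keys p. Poly_Mapping.single m (Poly_Mapping.lookup p m)) *
      (\<Sum>m\<in>Poly_Mapping.keys q. Poly_Mapping.single m (Poly_Mapping.lookup q m)))"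
    by (simp add: sum_single_keys)
  also have "\<dots> = eval a p * eval a q"
    by (simp add: sum_product eval_sum mult_single eval_single monomial_eval_add)
       (simp add: eval_def sum_product algebra_simps)
  finally show ?thesis .
qed

lemma eval_Const [simp]: "eval a (Const c) = c"
  by (simp add: Const_def eval_single monomial_eval_def)

lemma eval_1 [simp]: "eval a 1 = 1"
  using eval_Const[of a 1] by (simp add: Const_simps)

lemma eval_Var [simp]: "eval a (Var i) = a i"
  by (simp add: Var_def eval_single monomial_eval_def)

lemma eval_prod: "eval a (prod f A) = (\<Prod>x\<in>A. eval a (f x))"
  by (induction A rule: infinite_finite_induct) (auto simp: eval_mult)

text \<open>
  Points have the value \<open>undefined\<close> outside \<open>{1..n}\<close>, so that a zero is determined by its \<open>n\<close>
  coordinates and the set of zeros can be finite.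
\<close>

definition zeros :: "nat \<Rightarrow> 'a::field mpoly set \<Rightarrow> (nat \<Rightarrow> 'a) set"
  where "zeros n G = {a \<in> {1..n} \<rightarrow>\<^sub>E UNIV. \<forall>g\<in>G. eval a g = 0}"

section \<open>Ideals with a split separable polynomial in each variable\<close>

lemma prod_inverse_diff_cancel:
  fixes z :: "'a::field"
  shows "(\<Prod>w\<in>Z-{z}. inverse (z - w)) * (\<Prod>w\<in>Z-{z}. z - w) = 1"
  unfolding prod.distrib[symmetric] by (intro prod.neutral ballI left_inverse) auto

text \<open>
  The sum of the Lagrange basis polynomials has degree less than \<open>|Z|\<close> and takes the value \<open>1\<close> at
  all points of \<open>Z\<close>.
\<close>

lemma sum_lagrange_basis:
  fixes Z :: "'a::field set"
  assumes "finite Z" "Z \<noteq> {}"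
  shows "(\<Sum>z\<in>Z. Polynomial.smult (\<Prod>w\<in>Z-{z}. inverse (z - w)) (\<Prod>w\<in>Z-{z}. [:- w, 1:])) = 1"
    (is "?S = 1")
proof (rule poly_eqI_degree)
  have deg: "degree (\<Prod>w\<in>Z-{z}. [:- w, 1:]) < card Z" if "z \<in> Z" for z
  proof -
    have "degree (\<Prod>w\<in>Z-{z}. [:- w, 1:]) \<le> card (Z - {z})"
      using degree_prod_sum_le[of "Z - {z}" "\<lambda>w. [:- w, 1:]"] assms(1) by (simp add: o_def)
    then show ?thesis using card_Diff1_less[OF assms(1) that] by simp
  qed
  have "degree ?S \<le> card Z - 1"
    using deg by (intro degree_sum_le assms(1) order.trans[OF degree_smult_le]) force
  then show "degree ?S < card Z"
    using card_gt_0_iff[of Z] assms by linarith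
  show "degree (1 :: 'a poly) < card Z"
    using assms by (simp add: card_gt_0_iff)
next
  fix x assume x: "x \<in> Z"
  have "poly ?S x = (\<Sum>z\<in>Z. (\<Prod>w\<in>Z-{z}. inverse (z - w)) * (\<Prod>w\<in>Z-{z}. x - w))"
    by (simp add: poly_sum poly_prod)
  also have "\<dots> = (\<Sum>z\<in>Z. if z = x then 1 else 0)"
  proof (rule sum.cong)
    fix z assume z: "z \<in> Z"
    show "(\<Prod>w\<in>Z-{z}. inverse (z - w)) * (\<Prod>w\<in>Z-{z}. x - w) = (if z = x then 1 else 0)"
    proof (cases "z = x")
      case True
      then show ?thesis by (simp add: prod_inverse_diff_cancel)
    next
      case False
      then have "(\<Prod>w\<in>Z-{z}. x - w) = 0"
        using assms(1) x by (intro prod_zero) auto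
      then show ?thesis using False by simp
    qed
  qed simp
  also have "\<dots> = 1" using assms(1) x by simp
  finally show "poly ?S x = poly 1 x" by simp
qed

text \<open>
  Identities between univariate polynomials, which are proved by counting roots, are carried over to
  \<open>R\<^sub>n\<close> by substituting a variable \<open>x\<^sub>i\<close>.
\<close>

definition subst :: "'a::field mpoly \<Rightarrow> 'a poly \<Rightarrow> 'a mpoly"
  where "subst y p = poly (map_poly Const p) y"

lemma comm_ring_hom_Const: "comm_ring_hom Const"
  by unfold_locales (simp_all add: Const_simps)

lemma subst_simps:
  "subst y (sum f A) = (\<Sum>x\<in>A. subst y (f x))"
  "subst y (prod f A) = (\<Prod>x\<in>A. subst y (f x))"
  "subst y (Polynomial.smult c p) = Const c * subst y p"
  "subst y 1 = 1"
  "subst y [:c, 1:] = Const c + y"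
  "subst y (p - q) = subst y p - subst y q"
  "subst y (Polynomial.monom c k) = Const c * y ^ k"
proof -
  interpret comm_ring_hom Const by (rule comm_ring_hom_Const)
  interpret H: map_poly_comm_ring_hom Const ..
  show "subst y (sum f A) = (\<Sum>x\<in>A. subst y (f x))"
    "subst y (prod f A) = (\<Prod>x\<in>A. subst y (f x))"
    "subst y 1 = 1"
    "subst y [:c, 1:] = Const c + y"
    "subst y (p - q) = subst y p - subst y q"
    by (simp_all add: subst_def H.hom_sum H.hom_prod poly_sum poly_prod H.hom_minus Const_simps)
  show "subst y (Polynomial.smult c p) = Const c * subst y p"
    by (simp add: subst_def map_poly_hom_smult)
  show "subst y (Polynomial.monom c k) = Const c * y ^ k"
    by (simp add: subst_def map_poly_monom Const_simps poly_monom)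
qed

text \<open>
  Since \<open>Z\<close> is a set, the product over \<open>z \<in> Z\<close> of \<open>x\<^sub>i - z\<close> is separable.  Ideals that contain such a
  product for every variable are determined by their zeros, over any field and with an elementary proof.
\<close>

locale split_ideal =
  fixes F :: "'a::field itself" and n :: nat and G :: "'a mpoly set" and Z :: "'a set"
  assumes G: "G \<subseteq> carrier (poly_ring F n)"
    and Z: "finite Z" "Z \<noteq> {}"
    and split: "\<And>i. i \<in> {1..n} \<Longrightarrow> (\<Prod>z\<in>Z. Var i - Const z) \<in> genideal (poly_ring F n) G"
begin

abbreviation "R \<equiv> poly_ring F n"
abbreviation "J \<equiv> genideal R G"

sublocale R: cring R by (rule poly_ring_cring)
sublocale J: ideal J R by (rule R.genideal_ideal[OF G])

lemmas J_closed = ideal_poly_ring_closed[OF J.is_ideal]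

lemma J_sum: "(\<And>x. x \<in> A \<Longrightarrow> f x \<in> J) \<Longrightarrow> sum f A \<in> J"
  by (induction A rule: infinite_finite_induct) (auto simp: J_closed)

definition lagrange :: "'a \<Rightarrow> 'a mpoly \<Rightarrow> 'a mpoly"
  where "lagrange z y = Const (\<Prod>w\<in>Z-{z}. inverse (z - w)) * (\<Prod>w\<in>Z-{z}. y - Const w)"

text \<open>
  Modulo the ideal these are orthogonal idempotents: \<open>point_idem a\<close> is \<open>1\<close> at \<open>a\<close> and \<open>0\<close> at
  the other points of the grid \<open>Z\<^sup>n\<close>.
\<close>

definition point_idem :: "(nat \<Rightarrow> 'a) \<Rightarrow> 'a mpoly"
  where "point_idem a = (\<Prod>i\<in>{1..n}. lagrange (a i) (Var i))"

abbreviation "grid \<equiv> {1..n} \<rightarrow>\<^sub>E Z"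

lemma point_idem_closed [simp]: "point_idem a \<in> carrier R"
  unfolding point_idem_def lagrange_def by (intro poly_ring_sum_prod_closed poly_ring_closed)

text \<open>
  The sum over the grid factors into the sums \<open>\<Sum>\<^sub>z L\<^sub>z(x\<^sub>i)\<close>, which are all \<open>1\<close>.
\<close>

lemma sum_point_idem: "(\<Sum>a\<in>grid. point_idem a) = 1"
proof -
  have "(\<Sum>z\<in>Z. lagrange z y) = 1" for y
    using arg_cong[OF sum_lagrange_basis[OF Z], of "subst y"]
    by (simp add: subst_simps lagrange_def Const_neg)
  then show ?thesis
    unfolding point_idem_def using Z by (subst prod_sum_PiE[symmetric]) auto
qed

lemma eval_point_idem:
  assumes "a \<in> grid" "b \<in> grid"
  shows "eval b (point_idem a) = (if a = b then 1 else 0)"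
proof -
  have eq: "eval b (point_idem a) = (\<Prod>i\<in>{1..n}. (\<Prod>w\<in>Z-{a i}. inverse (a i - w)) * (\<Prod>w\<in>Z-{a i}. b i - w))"
    by (simp add: point_idem_def lagrange_def eval_prod eval_mult eval_diff)
  show ?thesis
  proof (cases "a = b")
    case True
    then show ?thesis unfolding eq by (simp add: prod_inverse_diff_cancel)
  next
    case False
    then obtain i where i: "i \<in> {1..n}" "a i \<noteq> b i"
      using assms by (metis PiE_ext)
    then have "(\<Prod>w\<in>Z-{a i}. b i - w) = 0"
      using Z assms by (intro prod_zero) auto
    then have "(\<Prod>w\<in>Z-{a i}. inverse (a i - w)) * (\<Prod>w\<in>Z-{a i}. b i - w) = 0" by simp
    with i(1) have "eval b (point_idem a) = 0"
      unfolding eq by (intro prod_zero) blast+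
    then show ?thesis using False by simp
  qed
qed

text \<open>
  The factor \<open>x\<^sub>i - a(i)\<close> supplies the one factor that the Lagrange polynomial \<open>L\<^bsub>a(i)\<^esub>(x\<^sub>i)\<close> is
  missing from the product over \<open>Z\<close>, which lies in the ideal.
\<close>

lemma Var_point_idem:
  assumes "a \<in> grid" "i \<in> {1..n}"
  shows "(Var i - Const (a i)) * point_idem a \<in> J"
proof -
  have "a i \<in> Z" using assms by auto
  define k where "k = Const (\<Prod>w\<in>Z-{a i}. inverse (a i - w))"
  define r where "r = (\<Prod>j\<in>{1..n}-{i}. lagrange (a j) (Var j))"
  have "point_idem a = lagrange (a i) (Var i) * r"
    unfolding point_idem_def r_def using assms(2) by (intro prod.remove) auto
  then have "(Var i - Const (a i)) * point_idem a =
      k * r * ((Var i - Const (a i)) * (\<Prod>w\<in>Z-{a i}. Var i - Const w))"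
    by (simp add: lagrange_def k_def algebra_simps)
  also have "(Var i - Const (a i)) * (\<Prod>w\<in>Z-{a i}. Var i - Const w) = (\<Prod>w\<in>Z. Var i - Const w)"
    using Z(1) \<open>a i \<in> Z\<close> by (intro prod.remove[symmetric])
  finally have eq: "(Var i - Const (a i)) * point_idem a = k * r * (\<Prod>w\<in>Z. Var i - Const w)" .
  have "k * r \<in> carrier R"
    unfolding k_def r_def lagrange_def by (intro poly_ring_sum_prod_closed poly_ring_closed) auto
  then show ?thesis
    unfolding eq using split[OF assms(2)] J_closed(5) by blast
qed

text \<open>Hence multiplication by \<open>p\<close> acts on the idempotent of \<open>a\<close> as the scalar \<open>p(a)\<close>.\<close>

lemma mult_point_idem:
  assumes p: "p \<in> carrier R" and a: "a \<in> grid"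
  shows "p * point_idem a - Const (eval a p) * point_idem a \<in> J"
  using p
proof (induction p rule: poly_ring_induct)
  case (Const c)
  then show ?case by (simp add: J_closed)
next
  case (Var i)
  then show ?case using Var_point_idem[OF a] by (simp add: algebra_simps)
next
  case (add p q)
  then show ?case using J_closed(2)[OF add(3,4)] by (simp add: eval_add Const_simps algebra_simps)
next
  case (mult p q)
  have "p * (q * point_idem a - Const (eval a q) * point_idem a) +
      Const (eval a q) * (p * point_idem a - Const (eval a p) * point_idem a) \<in> J"
    using mult by (intro J_closed(2,5)) auto
  then show ?case by (simp add: eval_mult Const_simps algebra_simps)
qed

text \<open>
  For a generator \<open>g\<close> with \<open>g(a) \<noteq> 0\<close>, the ideal contains \<open>g e\<^sub>a \<equiv> g(a) e\<^sub>a\<close>, and \<open>g(a)\<close> can be cancelled.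
\<close>

lemma point_idem_in_ideal:
  assumes a: "a \<in> grid" "a \<notin> zeros n G"
  shows "point_idem a \<in> J"
proof -
  have "a \<in> {1..n} \<rightarrow>\<^sub>E UNIV" using a(1) by auto
  then obtain g where g: "g \<in> G" "eval a g \<noteq> 0" using a(2) by (auto simp: zeros_def)
  then have gJ: "g \<in> J" using R.genideal_self[OF G] by auto
  have "point_idem a * g - (g * point_idem a - Const (eval a g) * point_idem a) \<in> J"
    by (rule J_closed(4)[OF J_closed(5)[OF gJ point_idem_closed] mult_point_idem[OF J_closed(1)[OF gJ] a(1)]])
  then have "Const (eval a g) * point_idem a \<in> J" by (simp add: mult.commute)
  then have "Const (inverse (eval a g)) * (Const (eval a g) * point_idem a) \<in> J"
    by (rule J_closed(5)) auto
  moreover have "Const (inverse (eval a g)) * Const (eval a g) = 1"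
    using g(2) by (simp add: Const_simps[symmetric])
  ultimately show ?thesis by (simp add: mult.assoc[symmetric])
qed

lemma eval_ideal:
  assumes "p \<in> J" "b \<in> zeros n G"
  shows "eval b p = 0"
proof -
  let ?K = "{p \<in> carrier R. eval b p = 0}"
  have "ideal ?K R"
  proof (rule idealI)
    show "subgroup ?K (add_monoid R)"
      using poly_ring_a_inv[of _ F n]
      by (intro R.add.subgroupI) (auto simp: eval_add a_inv_def[symmetric] eval_uminus intro!: exI[of _ 0])
  qed (auto simp: R.ring_axioms eval_mult)
  moreover have "G \<subseteq> ?K" using G assms(2) by (auto simp: zeros_def)
  ultimately show ?thesis using R.genideal_minimal[of ?K G] assms(1) by auto
qed

lemma zeros_subset_grid: "zeros n G \<subseteq> grid"
proof
  fix b assume b: "b \<in> zeros n G"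
  have "b i \<in> Z" if "i \<in> {1..n}" for i
    using eval_ideal[OF split[OF that] b] Z by (auto simp: eval_prod eval_diff)
  then show "b \<in> grid" using b by (auto simp: zeros_def PiE_iff)
qed

lemma finite_zeros: "finite (zeros n G)"
  using zeros_subset_grid by (rule finite_subset) (auto intro: finite_PiE Z)

text \<open>
  The ideal is radical.  Expanding \<open>p = \<Sum> p e\<^sub>a\<close> over the grid, each term is in the ideal, either since
  \<open>p(a) = 0\<close> or since \<open>a\<close> is not a zero of the ideal.
\<close>

theorem in_ideal_iff_vanishes:
  assumes "p \<in> carrier R"
  shows "p \<in> J \<longleftrightarrow> (\<forall>a\<in>zeros n G. eval a p = 0)"
proof
  assume z: "\<forall>a\<in>zeros n G. eval a p = 0"
  have "p * point_idem a \<in> J" if "a \<in> grid" for a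
    using mult_point_idem[OF assms that] z J_closed(5)[OF point_idem_in_ideal[OF that] assms]
    by (cases "a \<in> zeros n G") (auto simp: Const_simps)
  then have "(\<Sum>a\<in>grid. p * point_idem a) \<in> J" by (rule J_sum)
  then show "p \<in> J" by (simp add: sum_distrib_left[symmetric] sum_point_idem)
qed (auto intro: eval_ideal)

theorem interpolation_on_zeros: "\<exists>p\<in>carrier R. \<forall>a\<in>zeros n G. eval a p = f a"
proof (intro bexI ballI)
  fix b assume b: "b \<in> zeros n G"
  have "eval b (\<Sum>a\<in>zeros n G. Const (f a) * point_idem a) = (\<Sum>a\<in>zeros n G. f a * (if a = b then 1 else 0))"
    by (simp add: eval_sum eval_mult eval_point_idem[OF subsetD[OF zeros_subset_grid] subsetD[OF zeros_subset_grid b]])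
  also have "\<dots> = f b" using finite_zeros b by (subst sum.mono_neutral_cong_right[of _ "{b}"]) auto
  finally show "eval b (\<Sum>a\<in>zeros n G. Const (f a) * point_idem a) = f b" .
qed (intro poly_ring_sum_prod_closed, auto)

end

section \<open>The ideal \<open>I\<^sub>n\<close> contains a split separable polynomial in each variable\<close>

text \<open>
  By induction on the degree: after dividing by \<open>X - x\<close> for a root \<open>x\<close>, the quotient \<open>q\<close> satisfies
  \<open>p' = (X - x) q' + q\<close>, so \<open>x\<close> is not a root of \<open>q\<close>, and \<open>q\<close> is again separable.
\<close>

lemma alg_closed_separable_factorization:
  fixes p :: "'a::alg_closed_field poly"
  assumes "\<And>z. poly p z = 0 \<Longrightarrow> poly (pderiv p) z \<noteq> 0"
  shows "p = Polynomial.smult (lead_coeff p) (\<Prod>z | poly p z = 0. [:- z, 1:]) \<and>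
    card {z. poly p z = 0} = degree p"
  using assms
proof (induction "degree p" arbitrary: p)
  case 0
  then obtain c where p: "p = [:c:]" by (metis degree_eq_zeroE)
  then have "c \<noteq> 0" using 0(2)[of 0] by auto
  then show ?case using p by simp
next
  case (Suc d)
  then obtain x where x: "poly p x = 0"
    using alg_closed_imp_poly_has_root[of p] by auto
  then obtain q where p: "p = [:- x, 1:] * q"
    by (metis dvdE poly_eq_0_iff_dvd)
  have "p \<noteq> 0" using Suc.hyps(2) by auto
  then have "q \<noteq> 0" using p by auto
  then have deg: "degree p = Suc (degree q)" unfolding p by (subst degree_mult_eq) auto
  have pd: "poly (pderiv p) z = (z - x) * poly (pderiv q) z + poly q z" for z
  proof -
    have "pderiv p = [:- x, 1:] * pderiv q + q * pderiv [:- x, 1:]" unfolding p by (rule pderiv_mult)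
    then show ?thesis by (simp only:) (simp add: pderiv_pCons algebra_simps)
  qed
  have qx: "poly q x \<noteq> 0" using Suc.prems[OF x] pd[of x] by simp
  have "poly (pderiv q) z \<noteq> 0" if "poly q z = 0" for z
    using Suc.prems[of z] that pd[of z] by (auto simp: p)
  then have IH: "q = Polynomial.smult (lead_coeff q) (\<Prod>z | poly q z = 0. [:- z, 1:])"
      "card {z. poly q z = 0} = degree q"
    using Suc.hyps(1)[of q] Suc.hyps(2) deg by auto
  have roots: "{z. poly p z = 0} = insert x {z. poly q z = 0}"
    by (auto simp: p)
  have fin: "finite {z. poly q z = 0}" using poly_roots_finite[OF \<open>q \<noteq> 0\<close>] .
  have "p = [:- x, 1:] * Polynomial.smult (lead_coeff q) (\<Prod>z | poly q z = 0. [:- z, 1:])"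
    using p IH(1) by simp
  also have "\<dots> = Polynomial.smult (lead_coeff q) (\<Prod>z | poly p z = 0. [:- z, 1:])"
    unfolding roots using fin qx by (simp only: mult_smult_right) (simp add: prod.insert)
  also have "lead_coeff q = lead_coeff p"
    unfolding p lead_coeff_mult by simp
  finally have "p = Polynomial.smult (lead_coeff p) (\<Prod>z | poly p z = 0. [:- z, 1:])" .
  moreover have "card {z. poly p z = 0} = degree p"
    unfolding roots using fin qx IH(2) deg by simp
  ultimately show ?case by blast
qed

lemma card_roots_of_unity_alg_closed:
  assumes "k > 0"
  shows "card {z :: 'a::{alg_closed_field, field_char_0}. z ^ k = 1} = k"
proof -
  define p where "p = Polynomial.monom (1 :: 'a) k - 1"
  have "degree p = k"
    unfolding p_def using assms unfolding diff_conv_add_uminus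
    by (subst degree_add_eq_left) (auto simp: degree_monom_eq)
  moreover have "poly (pderiv p) z \<noteq> 0" if "poly p z = 0" for z
    using that assms by (auto simp: p_def poly_monom pderiv_diff pderiv_monom power_0_left)
  ultimately show ?thesis
    using alg_closed_separable_factorization[of p] by (simp add: p_def poly_monom)
qed

lemma prod_fixed_points_power:
  fixes k :: nat and y :: "'a::{alg_closed_field, field_char_0} mpoly"
  assumes "k \<ge> 2"
  shows "finite {z :: 'a. z ^ k = z}" "(\<Prod>z | z ^ k = z. y - Const z) = y ^ k - y"
proof -
  define p where "p = Polynomial.monom (1 :: 'a) k - Polynomial.monom 1 1"
  have deg: "degree p = k"
    unfolding p_def using assms unfolding diff_conv_add_uminus
    by (subst degree_add_eq_left) (auto simp: degree_monom_eq)
  have lead: "lead_coeff p = 1"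
    unfolding deg using assms by (simp add: p_def)
  have "poly (pderiv p) z \<noteq> 0" if z: "poly p z = 0" for z
  proof
    assume d: "poly (pderiv p) z = 0"
    have zk: "z ^ k = z" using z by (simp add: p_def poly_monom)
    have d': "of_nat k * z ^ (k - 1) = 1"
      using d by (simp add: p_def pderiv_diff pderiv_monom poly_monom)
    then have "of_nat k * (z * z ^ (k - 1)) = z" by (metis mult.left_commute mult.right_neutral)
    then have "of_nat k * z = z" using zk assms by (simp flip: power_Suc)
    then have "z = 0" using assms by (cases "z = 0") (auto simp: of_nat_eq_1_iff)
    then show False using d' assms by (simp add: power_0_left)
  qed
  then have p: "p = (\<Prod>z | poly p z = 0. [:- z, 1:])"
    using alg_closed_separable_factorization[of p] lead by simp
  have roots: "{z. poly p z = 0} = {z. z ^ k = z}" by (simp add: p_def poly_monom)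
  have "p \<noteq> 0" using lead by auto
  then show "finite {z :: 'a. z ^ k = z}" using poly_roots_finite roots by metis
  have "(\<Prod>z | z ^ k = z. y - Const z) = subst y (\<Prod>z | z ^ k = z. [:- z, 1:])"
    by (simp add: subst_simps Const_neg)
  also have "\<dots> = subst y p" using p roots by simp
  also have "\<dots> = y ^ k - y" by (simp add: p_def subst_simps Const_simps)
  finally show "(\<Prod>z | z ^ k = z. y - Const z) = y ^ k - y" .
qed

lemma I_gens_subset: "n \<ge> 2 \<Longrightarrow> I_gens F n \<subseteq> carrier (poly_ring F n)"
  unfolding I_gens_def by (auto intro!: poly_ring_closed poly_ring_sum_prod_closed)

text \<open>
  Let \<open>s\<close> be the product of all variables.  Multiplying the \<open>j\<close>-th generator by \<open>x\<^sub>j\<close> gives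
  \<open>x\<^sub>j\<^sup>2 \<equiv> s\<close>, so all squares agree.  Choose \<open>k \<noteq> i\<close> and let \<open>Q\<close> be the product of the other
  variables.  The generators for \<open>k\<close> and \<open>i\<close> are \<open>x\<^sub>i Q \<equiv> x\<^sub>k\<close> and \<open>x\<^sub>k Q \<equiv> x\<^sub>i\<close>, hence
  \<open>x\<^sub>i Q\<^sup>2 \<equiv> x\<^sub>i\<close>, where \<open>Q\<^sup>2 \<equiv> x\<^sub>i\<^bsup>2(n-2)\<^esup>\<close> as \<open>Q\<close> has \<open>n - 2\<close> factors.
\<close>

lemma Var_power_in_ideal:
  fixes F :: "'a::field itself"
  assumes n: "n \<ge> 3" and i: "i \<in> {1..n}"
  shows "Var i ^ (2 * n - 3) - Var i \<in> genideal (poly_ring F n) (I_gens F n)"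
proof -
  interpret R: cring "poly_ring F n" by (rule poly_ring_cring)
  define J where "J = genideal (poly_ring F n) (I_gens F n)"
  define x where "x = (Var :: nat \<Rightarrow> 'a mpoly)"
  have sub: "I_gens F n \<subseteq> carrier (poly_ring F n)" using n by (intro I_gens_subset) simp
  note J = ideal_poly_ring_closed[OF R.genideal_ideal[OF sub], folded J_def]
  have x: "x j \<in> carrier (poly_ring F n)" if "j \<in> {1..n}" for j
    using that unfolding x_def by (intro poly_ring_closed)
  have gen: "(\<Prod>l\<in>{1..n}-{j}. x l) - x j \<in> J" if "j \<in> {1..n}" for j
    using R.genideal_self[OF sub] that n unfolding J_def I_gens_def x_def by auto
  have sq: "x j ^ 2 - x i ^ 2 \<in> J" if j: "j \<in> {1..n}" for j
  proof -
    have "(\<Prod>l\<in>{1..n}. x l) - x j ^ 2 \<in> J" if j: "j \<in> {1..n}" for j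
    proof -
      have "x j * ((\<Prod>l\<in>{1..n}-{j}. x l) - x j) \<in> J" by (intro J(5) gen x j)
      also have "x j * ((\<Prod>l\<in>{1..n}-{j}. x l) - x j) = (\<Prod>l\<in>{1..n}. x l) - x j ^ 2"
        using j by (simp add: right_diff_distrib power2_eq_square prod.remove[of "{1..n}" j x])
      finally show ?thesis .
    qed
    from J(4)[OF this[OF i] this[OF j]] show ?thesis by simp
  qed
  have sq_prod: "(\<Prod>j\<in>A. x j ^ 2) - (\<Prod>j\<in>A. x i ^ 2) \<in> J" if "finite A" "A \<subseteq> {1..n}" for A
    using that
  proof (induction A rule: finite_induct)
    case empty
    then show ?case using J(3) by simp
  next
    case (insert j A)
    have "(\<Prod>l\<in>A. x l ^ 2) * (x j ^ 2 - x i ^ 2) +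
        x i ^ 2 * ((\<Prod>l\<in>A. x l ^ 2) - (\<Prod>l\<in>A. x i ^ 2)) \<in> J"
      using insert i by (intro J(2,5) sq poly_ring_sum_prod_closed poly_ring_power_closed x) auto
    then show ?case using insert by (simp add: algebra_simps)
  qed
  obtain k where k: "k \<in> {1..n}" "k \<noteq> i"
    using n i that[of 1] that[of 2] by (cases "i = 1") auto
  define Q where "Q = (\<Prod>l\<in>{1..n}-{i,k}. x l)"
  have Q: "Q \<in> carrier (poly_ring F n)"
    unfolding Q_def by (intro poly_ring_sum_prod_closed x) auto
  have "x i * Q = (\<Prod>l\<in>{1..n}-{k}. x l)"
    using prod.remove[of "{1..n}-{k}" i x] i k
    by (simp add: Q_def Diff_insert2[symmetric] insert_commute)
  moreover have "x k * Q = (\<Prod>l\<in>{1..n}-{i}. x l)"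
    using prod.remove[of "{1..n}-{i}" k x] i k
    by (simp add: Q_def Diff_insert2[symmetric] insert_commute)
  ultimately have g: "x i * Q - x k \<in> J" "x k * Q - x i \<in> J"
    using gen[OF k(1)] gen[OF i] by simp_all
  have card: "card ({1..n} - {i, k}) = n - 2"
    using i k by (subst card_Diff_subset) auto
  have "Q ^ 2 - (x i ^ 2) ^ (n - 2) \<in> J"
    using sq_prod[of "{1..n} - {i, k}"]
    unfolding Q_def prod_power_distrib[symmetric, of x] prod_constant card by simp
  from J(5)[OF this x[OF i]] have "x i * Q ^ 2 - x i * (x i ^ 2) ^ (n - 2) \<in> J"
    by (simp add: algebra_simps)
  moreover have "x i * Q ^ 2 - x i \<in> J"
    using J(2)[OF J(5)[OF g(1) Q] g(2)] by (simp add: algebra_simps power2_eq_square)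
  ultimately have "(x i * Q ^ 2 - x i) - (x i * Q ^ 2 - x i * (x i ^ 2) ^ (n - 2)) \<in> J"
    by (rule J(4)[rotated])
  also have "(x i * Q ^ 2 - x i) - (x i * Q ^ 2 - x i * (x i ^ 2) ^ (n - 2)) = x i ^ (2 * n - 3) - x i"
  proof -
    have "2 * n - 3 = Suc (2 * (n - 2))" using n by simp
    then show ?thesis by (simp add: power_mult)
  qed
  finally show ?thesis unfolding J_def x_def .
qed

lemma I_is_split_ideal:
  fixes F :: "'a::{alg_closed_field, field_char_0} itself"
  assumes "n \<ge> 2"
  shows "\<exists>Z. split_ideal F n (I_gens F n) Z"
proof (cases "n = 2")
  case True
  interpret R: cring "poly_ring F n" by (rule poly_ring_cring)
  have "i = 1 \<or> i = 2" if "i \<in> {1..2}" for i :: nat using that by auto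
  then have "split_ideal F n (I_gens F n) {0}"
    using R.genideal_self[OF I_gens_subset[OF assms]] True I_gens_subset[OF assms]
    by unfold_locales (auto simp: I_gens_def Const_simps)
  then show ?thesis ..
next
  case False
  then have n: "n \<ge> 3" using assms by simp
  have "split_ideal F n (I_gens F n) {z. z ^ (2 * n - 3) = z}"
  proof
    show "{z :: 'a. z ^ (2 * n - 3) = z} \<noteq> {}" using power_one by blast
  qed (use n Var_power_in_ideal[OF n, where F = F] I_gens_subset[OF assms] in
      \<open>simp_all add: prod_fixed_points_power\<close>)
  then show ?thesis ..
qed

section \<open>The zeros of \<open>I\<^sub>n\<close>\<close>

lemma zeros_I_gens_2: "zeros 2 (I_gens F 2) = {\<lambda>i\<in>{1..2}. 0}"
proof -
  have two: "{1..2} = {1, 2 :: nat}" by auto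
  show ?thesis
    unfolding zeros_def I_gens_def two
    by (auto simp: fun_eq_iff PiE_def extensional_def restrict_def)
qed

lemma zeros_I_gens:
  assumes "n \<ge> 3"
  shows "zeros n (I_gens F n) = {a \<in> {1..n} \<rightarrow>\<^sub>E UNIV. \<forall>i\<in>{1..n}. (\<Prod>j\<in>{1..n}-{i}. a j) = a i}"
proof -
  have "I_gens F n = (\<lambda>i. (\<Prod>j\<in>{1..n}-{i}. Var j) - Var i) ` {1..n}"
    unfolding I_gens_def using assms by auto
  then show ?thesis by (simp add: zeros_def eval_diff eval_prod)
qed

definition sign_point :: "nat \<Rightarrow> 'a::field \<Rightarrow> nat set \<Rightarrow> nat \<Rightarrow> 'a"
  where "sign_point n t A = (\<lambda>i\<in>{1..n}. if i \<in> A then - t else t)"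

lemma prod_sign_point:
  assumes "A \<subseteq> {1..n}"
  shows "(\<Prod>i\<in>{1..n}. sign_point n t A i) = (- 1) ^ card A * t ^ n"
proof -
  have "(\<Prod>i\<in>{1..n}. sign_point n t A i) = (\<Prod>i\<in>{1..n}. (if i \<in> A then - 1 else 1) * t)"
    by (intro prod.cong) (auto simp: sign_point_def)
  also have "\<dots> = (\<Prod>i\<in>{1..n}. if i \<in> A then - 1 else 1) * t ^ n"
    by (simp add: prod.distrib)
  also have "(\<Prod>i\<in>{1..n}. if i \<in> A then - 1 else (1 :: 'a)) = (\<Prod>i\<in>{1..n} \<inter> A. - 1)"
    by (subst prod.inter_restrict) auto
  also have "{1..n} \<inter> A = A" using assms by auto
  finally show ?thesis by simp
qed

text \<open>
  At a zero \<open>a\<close>, multiplying the \<open>i\<close>-th equation by \<open>a\<^sub>i\<close> shows that \<open>a\<^sub>i\<^sup>2\<close> is the product \<open>s\<close> of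
  all coordinates.  So \<open>a\<^sub>i = \<plusminus>r(s)\<close>, and comparing \<open>s\<close> with the product \<open>(-1)\<^bsup>|A|\<^esup> r(s)\<^sup>n\<close> of the
  coordinates leaves \<open>r(s)\<^bsup>n-2\<^esup> = (-1)\<^bsup>|A|\<^esup>\<close>.  Conversely, as the coordinates are nonzero, the equations can
  be recovered from the multiplied ones.  Characteristic \<open>0\<close> is used for \<open>r(s) \<noteq> -r(s)\<close>.
\<close>

lemma nonzero_zeros_I_gens:
  fixes F :: "'a::field_char_0 itself" and r :: "'a \<Rightarrow> 'a"
  assumes n: "n \<ge> 3" and r: "\<And>s. r s ^ 2 = s"
  defines "D \<equiv> {(s, A). s \<noteq> 0 \<and> A \<subseteq> {1..n} \<and> r s ^ (n - 2) = (- 1) ^ card A}"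
  shows "bij_betw (\<lambda>(s, A). sign_point n (r s) A) D (zeros n (I_gens F n) - {\<lambda>i\<in>{1..n}. 0})"
proof -
  have one: "1 \<in> {1..n}" using n by simp
  have r0: "r s \<noteq> 0" if "s \<noteq> 0" for s using r[of s] that by auto
  have neg: "r s \<noteq> - r s" if "s \<noteq> 0" for s
    using r0[OF that] by (simp add: eq_neg_iff_add_eq_0 flip: mult_2)
  have sq: "sign_point n (r s) A i ^ 2 = s" if "i \<in> {1..n}" for s A i
    using that r[of s] by (simp add: sign_point_def)
  have inj: "inj_on (\<lambda>(s, A). sign_point n (r s) A) D"
  proof (rule inj_onI, clarify)
    fix s A s' A'
    assume D: "(s, A) \<in> D" "(s', A') \<in> D"
      and eq: "sign_point n (r s) A = sign_point n (r s') A'"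
    have s: "s = s'" using sq[OF one, of s A] sq[OF one, of s' A'] eq by simp
    have "i \<in> A \<longleftrightarrow> i \<in> A'" if i: "i \<in> {1..n}" for i
      using fun_cong[OF eq, of i] i s neg[of s] D
      by (auto simp: sign_point_def D_def split: if_splits)
    then show "s = s' \<and> A = A'" using s D by (auto simp: D_def)
  qed
  have "(\<lambda>(s, A). sign_point n (r s) A) ` D = zeros n (I_gens F n) - {\<lambda>i\<in>{1..n}. 0}"
  proof (intro equalityI subsetI)
    fix a assume "a \<in> (\<lambda>(s, A). sign_point n (r s) A) ` D"
    then obtain s A where sA: "s \<noteq> 0" "A \<subseteq> {1..n}" "r s ^ (n - 2) = (- 1) ^ card A"
      and a: "a = sign_point n (r s) A" by (auto simp: D_def)
    have n2: "n = n - 2 + 2" using n by simp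
    have "(\<Prod>i\<in>{1..n}. a i) = (- 1) ^ card A * (r s ^ (n - 2) * r s ^ 2)"
      unfolding a prod_sign_point[OF sA(2)] using n2 by (metis power_add)
    also have "\<dots> = s" by (simp add: sA(3) r mult.assoc[symmetric] flip: power_add mult_2)
    finally have P: "(\<Prod>i\<in>{1..n}. a i) = s" .
    have "(\<Prod>j\<in>{1..n}-{i}. a j) = a i" if i: "i \<in> {1..n}" for i
    proof -
      have "a i * (\<Prod>j\<in>{1..n}-{i}. a j) = a i * a i"
        using P sq[OF i, of s A] i by (simp add: a power2_eq_square prod.remove[of "{1..n}" i])
      moreover have "a i \<noteq> 0" using sq[OF i, of s A] sA(1) by (auto simp: a)
      ultimately show ?thesis by simp
    qed
    moreover have "a \<noteq> (\<lambda>i\<in>{1..n}. 0)"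
      using sq[OF one, of s A] sA(1) one unfolding a by auto
    ultimately show "a \<in> zeros n (I_gens F n) - {\<lambda>i\<in>{1..n}. 0}"
      unfolding zeros_I_gens[OF n] by (auto simp: a sign_point_def)
  next
    fix a assume "a \<in> zeros n (I_gens F n) - {\<lambda>i\<in>{1..n}. 0}"
    then have ext: "a \<in> {1..n} \<rightarrow>\<^sub>E UNIV" and a0: "a \<noteq> (\<lambda>i\<in>{1..n}. 0)"
      and ai: "\<And>i. i \<in> {1..n} \<Longrightarrow> (\<Prod>j\<in>{1..n}-{i}. a j) = a i"
      unfolding zeros_I_gens[OF n] by auto
    define s where "s = (\<Prod>i\<in>{1..n}. a i)"
    have as: "a i ^ 2 = s" if "i \<in> {1..n}" for i
      using ai[OF that] that unfolding s_def by (simp add: power2_eq_square prod.remove[of "{1..n}" i])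
    have s0: "s \<noteq> 0"
    proof
      assume "s = 0"
      then have "a i = (\<lambda>i\<in>{1..n}. 0) i" for i
        using as[of i] PiE_arb[OF ext, of i] by (cases "i \<in> {1..n}") simp_all
      then show False using a0 by blast
    qed
    define A where "A = {i \<in> {1..n}. a i = - r s}"
    have a: "a = sign_point n (r s) A"
    proof
      fix i show "a i = sign_point n (r s) A i"
        using as[of i] r[of s] ext power2_eq_iff[of "a i" "r s"]
        by (auto simp: sign_point_def A_def PiE_def extensional_def)
    qed
    have A: "A \<subseteq> {1..n}" by (auto simp: A_def)
    have n2: "n = n - 2 + 2" using n by simp
    have "s = (- 1) ^ card A * (r s ^ (n - 2) * r s ^ 2)"
      using prod_sign_point[OF A, of "r s"] n2 unfolding s_def[symmetric] a[symmetric]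
      by (metis power_add)
    then have "(- 1) ^ card A * r s ^ (n - 2) = 1" using s0 by (simp add: r)
    then have "r s ^ (n - 2) = (- 1) ^ card A"
      by (cases "even (card A)") (auto simp: equation_minus_iff)
    then show "a \<in> (\<lambda>(s, A). sign_point n (r s) A) ` D"
      using a A s0 by (auto simp: D_def)
  qed
  with inj show ?thesis by (simp add: bij_betw_def)
qed

section \<open>Isomorphisms of representations\<close>

lemma linear_mapI:
  assumes "vectorspace K V" "vectorspace K W" "T \<in> carrier V \<rightarrow> carrier W"
    and "\<And>v w. v \<in> carrier V \<Longrightarrow> w \<in> carrier V \<Longrightarrow> T (v \<oplus>\<^bsub>V\<^esub> w) = T v \<oplus>\<^bsub>W\<^esub> T w"
    and "\<And>c v. c \<in> carrier K \<Longrightarrow> v \<in> carrier V \<Longrightarrow> T (c \<odot>\<^bsub>V\<^esub> v) = c \<odot>\<^bsub>W\<^esub> T v"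
  shows "linear_map K V W T"
  using assms unfolding linear_map_def mod_hom_def mod_hom_axioms_def LinearCombinations.module_hom_def vectorspace_def
  by auto

lemma linear_mapD:
  assumes "linear_map K V W T"
  shows "vectorspace K V" "vectorspace K W" "T \<in> carrier V \<rightarrow> carrier W"
    and "\<And>v w. v \<in> carrier V \<Longrightarrow> w \<in> carrier V \<Longrightarrow> T (v \<oplus>\<^bsub>V\<^esub> w) = T v \<oplus>\<^bsub>W\<^esub> T w"
    and "\<And>c v. c \<in> carrier K \<Longrightarrow> v \<in> carrier V \<Longrightarrow> T (c \<odot>\<^bsub>V\<^esub> v) = c \<odot>\<^bsub>W\<^esub> T v"
  using assms unfolding linear_map_def mod_hom_def mod_hom_axioms_def LinearCombinations.module_hom_def by auto

lemma rep_iso_trans: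
  assumes "rep_iso G V \<rho> W \<sigma>" "rep_iso G W \<sigma> U \<tau>"
  shows "rep_iso G V \<rho> U \<tau>"
proof -
  obtain T where T: "linear_map class_ring V W T" "bij_betw T (carrier V) (carrier W)"
      "\<forall>g\<in>carrier G. \<forall>v\<in>carrier V. T (\<rho> g v) = \<sigma> g (T v)"
    using assms(1) unfolding rep_iso_def by blast
  obtain S where S: "linear_map class_ring W U S" "bij_betw S (carrier W) (carrier U)"
      "\<forall>g\<in>carrier G. \<forall>v\<in>carrier W. S (\<sigma> g v) = \<tau> g (S v)"
    using assms(2) unfolding rep_iso_def by blast
  note lT = linear_mapD[OF T(1)] and lS = linear_mapD[OF S(1)]
  have Tc: "T v \<in> carrier W" if "v \<in> carrier V" for v using lT(3) that by auto
  have "linear_map class_ring V U (S \<circ> T)"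
    by (rule linear_mapI) (use lT lS Tc in \<open>auto simp: Pi_iff\<close>)
  moreover have "bij_betw (S \<circ> T) (carrier V) (carrier U)"
    using T(2) S(2) by (rule bij_betw_trans)
  ultimately show ?thesis
    unfolding rep_iso_def using T(3) S(3) Tc by (intro exI[of _ "S \<circ> T"]) auto
qed

text \<open>
  Equivariance of the inverse at \<open>T v\<close> is obtained from \<open>T (\<rho> g v) = \<sigma> g (T v)\<close> by cancelling \<open>T\<close>, which
  is injective only on the carrier of \<open>V\<close>; therefore \<open>\<rho> g\<close> has to preserve it.
\<close>

lemma rep_iso_sym:
  fixes V :: "('a::field, 'v) module"
  assumes "rep_iso G V \<rho> W \<sigma>"
    and cl: "\<And>g v. g \<in> carrier G \<Longrightarrow> v \<in> carrier V \<Longrightarrow> \<rho> g v \<in> carrier V"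
  shows "rep_iso G W \<sigma> V \<rho>"
proof -
  obtain T where T: "linear_map class_ring V W T" "bij_betw T (carrier V) (carrier W)"
      "\<forall>g\<in>carrier G. \<forall>v\<in>carrier V. T (\<rho> g v) = \<sigma> g (T v)"
    using assms(1) unfolding rep_iso_def by blast
  note lT = linear_mapD[OF T(1)]
  interpret V: vectorspace class_ring V by (rule lT(1))
  interpret W: vectorspace class_ring W by (rule lT(2))
  define S where "S = inv_into (carrier V) T"
  have ST: "S (T v) = v" if "v \<in> carrier V" for v
    using T(2) that unfolding S_def by (simp add: bij_betw_inv_into_left)
  have TS: "S w \<in> carrier V" "T (S w) = w" if "w \<in> carrier W" for w
    using T(2) that unfolding S_def
    by (auto simp: bij_betw_inv_into_right bij_betw_def inv_into_into)
  have "linear_map class_ring W V S"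
  proof (rule linear_mapI)
    fix v w assume vw: "v \<in> carrier W" "w \<in> carrier W"
    have "S (T (S v \<oplus>\<^bsub>V\<^esub> S w)) = S v \<oplus>\<^bsub>V\<^esub> S w" using vw by (intro ST V.add.m_closed TS)
    then show "S (v \<oplus>\<^bsub>W\<^esub> w) = S v \<oplus>\<^bsub>V\<^esub> S w" using vw by (simp add: lT(4) TS)
  next
    fix c :: 'a and v assume v: "v \<in> carrier W"
    have c: "c \<in> carrier class_ring" by simp
    have "S (T (c \<odot>\<^bsub>V\<^esub> S v)) = c \<odot>\<^bsub>V\<^esub> S v"
      using V.smult_closed[OF c TS(1)[OF v]] by (rule ST)
    then show "S (c \<odot>\<^bsub>W\<^esub> v) = c \<odot>\<^bsub>V\<^esub> S v" using lT(5)[OF c TS(1)[OF v]] TS(2)[OF v] by simp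
  qed (use lT TS in auto)
  moreover have "bij_betw S (carrier W) (carrier V)"
    unfolding S_def using T(2) by (rule bij_betw_inv_into)
  moreover have "S (\<sigma> g w) = \<rho> g (S w)" if "g \<in> carrier G" "w \<in> carrier W" for g w
    using T(3) that TS[OF that(2)] ST[OF cl[OF that(1) TS(1)[OF that(2)]]] by metis
  ultimately show ?thesis unfolding rep_iso_def by blast
qed

lemma GL_simps:
  "carrier (GL F d) = {A \<in> carrier_mat d d. \<exists>B\<in>carrier_mat d d. B * A = 1\<^sub>m d \<and> A * B = 1\<^sub>m d}"
  "monoid.mult (GL F d) = (*)" "one (GL F d) = 1\<^sub>m d"
  by (auto simp: GL_def units_of_def Units_def ring_mat_simps)

lemma mat_repsD:
  fixes M :: "'g \<Rightarrow> 'a::field mat"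
  assumes "group G" "M \<in> mat_reps G" "g \<in> carrier G"
  shows "M g \<in> carrier_mat (mat_deg G M) (mat_deg G M)"
proof -
  obtain d where d: "M \<in> hom G (GL TYPE('a) d)" using assms(2) by (auto simp: mat_reps_def)
  have c: "M h \<in> carrier_mat d d" if "h \<in> carrier G" for h
    using d that by (auto simp: hom_def Pi_iff GL_simps)
  have "mat_deg G M = d"
    using c[of "\<one>\<^bsub>G\<^esub>"] assms(1) by (auto simp: mat_deg_def group.is_monoid)
  then show ?thesis using c[OF assms(3)] by simp
qed

lemma mat_act_closed:
  assumes "group G" "M \<in> mat_reps G" "g \<in> carrier G" "v \<in> carrier (mat_space G M)"
  shows "mat_act M g v \<in> carrier (mat_space G M)"
  using mat_repsD[OF assms(1-3)] assms(4) by (auto simp: mat_space_def mat_act_def module_vec_simps)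

text \<open>Only the values of a matrix representation on the group matter for its isomorphism type.\<close>

lemma mat_reps_cong:
  assumes "group G" "\<And>g. g \<in> carrier G \<Longrightarrow> M g = N g"
  shows "M \<in> mat_reps G \<longleftrightarrow> N \<in> mat_reps G"
    and "rep_iso G (mat_space G M) (mat_act M) V \<rho> \<longleftrightarrow> rep_iso G (mat_space G N) (mat_act N) V \<rho>"
proof -
  interpret group G by (rule assms(1))
  have "M \<in> hom G H \<longleftrightarrow> N \<in> hom G H" for H :: "'c mat monoid"
    using assms(2) by (auto simp: hom_def Pi_iff)
  then show "M \<in> mat_reps G \<longleftrightarrow> N \<in> mat_reps G" by (simp add: mat_reps_def)
  have "mat_space G M = mat_space G N" using assms(2) by (simp add: mat_space_def mat_deg_def)
  then show "rep_iso G (mat_space G M) (mat_act M) V \<rho> \<longleftrightarrow> rep_iso G (mat_space G N) (mat_act N) V \<rho>"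
    using assms(2) by (simp add: rep_iso_def mat_act_def)
qed

section \<open>Classes in the representation ring\<close>

text \<open>
  Addition and zero of a quotient ring depend only on the ideal as an additive subgroup, and \<open>Rep(G)\<close> enters
  the theorem only through its addition and its unit element.  So the computations below rest on two facts about
  \<open>rep_ideal\<close>: it is closed under addition, and it contains the relations with their negatives.
\<close>

abbreviation rep_coset ::
  "'a::field itself \<Rightarrow> ('g, 'm) monoid_scheme \<Rightarrow> (('g \<Rightarrow> 'a mat) \<Rightarrow>\<^sub>0 int) \<Rightarrow> (('g \<Rightarrow> 'a mat) \<Rightarrow>\<^sub>0 int) set"
  where "rep_coset F G x \<equiv> rep_ideal F G +>\<^bsub>free_rep_ring F G\<^esub> x"

lemma rep_ideal_TYPE: "rep_ideal TYPE('a::field) G = rep_ideal (F :: 'a itself) G"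
    "free_rep_ring TYPE('a::field) G = free_rep_ring (F :: 'a itself) G"
  by (simp_all add: rep_ideal_def rep_relations_def free_rep_ring_def)

lemma mem_rep_coset: "y \<in> rep_coset F G x \<longleftrightarrow> y - x \<in> rep_ideal F G"
proof -
  have "y \<in> rep_coset F G x \<longleftrightarrow> (\<exists>h\<in>rep_ideal F G. y = h + x)"
    by (auto simp: a_r_coset_def' free_rep_ring_def)
  also have "\<dots> \<longleftrightarrow> y - x \<in> rep_ideal F G"
    by (metis add_diff_cancel_right' diff_add_cancel)
  finally show ?thesis .
qed

lemma rep_ideal_0: "0 \<in> rep_ideal F G"
  unfolding rep_ideal_def using generate.one[of "add_monoid (free_rep_ring F G)"]
  by (simp add: free_rep_ring_def)

lemma rep_ideal_add: "x \<in> rep_ideal F G \<Longrightarrow> y \<in> rep_ideal F G \<Longrightarrow> x + y \<in> rep_ideal F G"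
  unfolding rep_ideal_def using generate.eng[of x "add_monoid (free_rep_ring F G)" _ y]
  by (simp add: free_rep_ring_def)

text \<open>
  The generated subgroup contains group inverses of the relations; these are the negatives once the relation is
  known to lie in the carrier.
\<close>

lemma rep_ideal_relation:
  assumes "r \<in> rep_relations F G" "Poly_Mapping.keys r \<subseteq> mat_reps G"
  shows "r \<in> rep_ideal F G" "- r \<in> rep_ideal F G"
proof -
  let ?A = "add_monoid (free_rep_ring F G)"
  show "r \<in> rep_ideal F G" unfolding rep_ideal_def using assms(1) by (rule generate.incl)
  have "inv\<^bsub>?A\<^esub> r = - r"
    unfolding m_inv_def using assms(2)
    by (intro the_equality) (auto simp: free_rep_ring_def eq_neg_iff_add_eq_0 add.commute)
  then show "- r \<in> rep_ideal F G"
    unfolding rep_ideal_def using generate.inv[OF assms(1), of ?A] by simp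
qed

lemma rep_coset_eqI:
  assumes "x - y \<in> rep_ideal F G" "y - x \<in> rep_ideal F G"
  shows "rep_coset F G x = rep_coset F G y"
proof (rule Set.set_eqI)
  fix z
  have "z - y \<in> rep_ideal F G" if "z - x \<in> rep_ideal F G"
    using rep_ideal_add[OF that assms(1)] by simp
  moreover have "z - x \<in> rep_ideal F G" if "z - y \<in> rep_ideal F G"
    using rep_ideal_add[OF that assms(2)] by simp
  ultimately show "z \<in> rep_coset F G x \<longleftrightarrow> z \<in> rep_coset F G y"
    unfolding mem_rep_coset by auto
qed

lemma rep_ring_simps:
  "one (rep_ring F G) = rep_coset F G (frag_of trivial_rep)"
  "zero (rep_ring F G) = rep_coset F G 0"
  "rep_coset F G x \<oplus>\<^bsub>rep_ring F G\<^esub> rep_coset F G y = rep_coset F G (x + y)"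
proof -
  show "one (rep_ring F G) = rep_coset F G (frag_of trivial_rep)"
    by (simp add: rep_ring_def FactRing_def free_rep_ring_def)
  show "zero (rep_ring F G) = rep_coset F G 0"
    by (rule Set.set_eqI) (simp only: mem_rep_coset, simp add: rep_ring_def FactRing_def)
  have "rep_coset F G x \<oplus>\<^bsub>rep_ring F G\<^esub> rep_coset F G y =
      {a + b | a b. a \<in> rep_coset F G x \<and> b \<in> rep_coset F G y}"
    by (auto simp: rep_ring_def FactRing_def set_add_def' free_rep_ring_def)
  also have "\<dots> = rep_coset F G (x + y)"
  proof (intro equalityI subsetI)
    fix z assume "z \<in> {a + b | a b. a \<in> rep_coset F G x \<and> b \<in> rep_coset F G y}"
    then obtain a b where z: "z = a + b" "a - x \<in> rep_ideal F G" "b - y \<in> rep_ideal F G"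
      by (auto simp only: mem_rep_coset)
    have "z - (x + y) = (a - x) + (b - y)" using z(1) by simp
    then show "z \<in> rep_coset F G (x + y)"
      using rep_ideal_add[OF z(2,3)] by (simp only: mem_rep_coset)
  next
    fix z assume "z \<in> rep_coset F G (x + y)"
    then have "z - y - x \<in> rep_ideal F G" by (simp add: mem_rep_coset algebra_simps)
    then show "z \<in> {a + b | a b. a \<in> rep_coset F G x \<and> b \<in> rep_coset F G y}"
      using rep_ideal_0[of F G]
      by (intro CollectI exI[of _ "z - y"] exI[of _ y]) (simp add: mem_rep_coset)
  qed
  finally show "rep_coset F G x \<oplus>\<^bsub>rep_ring F G\<^esub> rep_coset F G y = rep_coset F G (x + y)" .
qed

text \<open>
  The union that defines a class consists of a single coset, because any two matrix representations
  isomorphic to \<open>V\<close> are isomorphic to each other.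
\<close>

lemma rep_class_eq_coset:
  fixes F :: "'a::field itself" and M :: "'g \<Rightarrow> 'a mat"
  assumes G: "group G" and M: "M \<in> mat_reps G"
    and iso: "rep_iso G (mat_space G M) (mat_act M) V \<rho>"
  shows "rep_class G V \<rho> = rep_coset F G (frag_of M)"
proof -
  have "rep_coset F G (frag_of N) = rep_coset F G (frag_of M)"
    if N: "N \<in> mat_reps G" "rep_iso G (mat_space G N) (mat_act N) V \<rho>" for N
  proof -
    have "rep_iso G (mat_space G N) (mat_act N) (mat_space G M) (mat_act M)"
      by (rule rep_iso_trans[OF N(2) rep_iso_sym[OF iso mat_act_closed[OF G M]]])
    then have r: "frag_of N - frag_of M \<in> rep_relations F G"
      unfolding rep_relations_def using M N(1) by blast
    have k: "Poly_Mapping.keys (frag_of N - frag_of M) \<subseteq> mat_reps G"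
      using keys_diff[of "frag_of N" "frag_of M"] M N(1) by (auto simp: keys_frag_of)
    show ?thesis using rep_ideal_relation[OF r k] by (intro rep_coset_eqI) simp_all
  qed
  then show ?thesis
    unfolding rep_class_def rep_ideal_TYPE[where F = F] using M iso by blast
qed

lemma rep_class_cong_iso:
  assumes "rep_iso G V \<rho> W \<sigma>"
    and "\<And>g v. g \<in> carrier G \<Longrightarrow> v \<in> carrier V \<Longrightarrow> \<rho> g v \<in> carrier V"
  shows "rep_class G V \<rho> = rep_class G W \<sigma>"
proof -
  have "rep_iso G (mat_space G M) (mat_act M) V \<rho> \<longleftrightarrow> rep_iso G (mat_space G M) (mat_act M) W \<sigma>" for M
    using rep_iso_trans[OF _ assms(1)] rep_iso_trans[OF _ rep_iso_sym[OF assms]] by blast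
  then show ?thesis by (simp add: rep_class_def)
qed

section \<open>Permutation representations\<close>

locale finite_gset = group G for G (structure) +
  fixes X :: "'x set" and \<phi> :: "'a \<Rightarrow> 'x \<Rightarrow> 'x"
  assumes finite_X: "finite X"
    and act_closed: "\<And>g x. g \<in> carrier G \<Longrightarrow> x \<in> X \<Longrightarrow> \<phi> g x \<in> X"
    and act_one: "\<And>x. x \<in> X \<Longrightarrow> \<phi> \<one> x = x"
    and act_mult: "\<And>g h x. g \<in> carrier G \<Longrightarrow> h \<in> carrier G \<Longrightarrow> x \<in> X \<Longrightarrow> \<phi> (g \<otimes> h) x = \<phi> g (\<phi> h x)"

text \<open>
  An enumeration \<open>xs\<close> of the \<open>G\<close>-set, rather than the set, indexes rows and columns, so that a
  disjoint union corresponds to appending lists.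
\<close>

definition perm_mat :: "('g \<Rightarrow> 'x \<Rightarrow> 'x) \<Rightarrow> 'x list \<Rightarrow> 'g \<Rightarrow> 'a::field mat"
  where "perm_mat \<phi> xs g =
    mat (length xs) (length xs) (\<lambda>(i, j). if \<phi> g (xs ! j) = xs ! i then 1 else 0)"

lemma (in finite_gset) perm_mat_mult:
  assumes xs: "distinct xs" "set xs = X" and g: "g \<in> carrier G" and h: "h \<in> carrier G"
  shows "(perm_mat \<phi> xs (g \<otimes> h) :: 'k::field mat) = perm_mat \<phi> xs g * perm_mat \<phi> xs h"
proof (rule eq_matI)
  let ?n = "length xs"
  fix i j assume "i < dim_row (perm_mat \<phi> xs g * perm_mat \<phi> xs h :: 'k mat)"
    "j < dim_col (perm_mat \<phi> xs g * perm_mat \<phi> xs h :: 'k mat)"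
  then have i: "i < ?n" and j: "j < ?n" by (auto simp: perm_mat_def)
  have x: "xs ! k \<in> X" if "k < ?n" for k using that xs by auto
  obtain l where l: "l < ?n" "xs ! l = \<phi> h (xs ! j)"
    using act_closed[OF h x[OF j]] xs by (metis in_set_conv_nth)
  have "(perm_mat \<phi> xs g * perm_mat \<phi> xs h :: 'k mat) $$ (i, j) =
      (\<Sum>k<?n. (if \<phi> g (xs ! k) = xs ! i then 1 else 0) * (if \<phi> h (xs ! j) = xs ! k then 1 else 0))"
    using i j by (simp add: perm_mat_def scalar_prod_def lessThan_atLeast0)
  also have "\<dots> = (\<Sum>k<?n. if k = l then (if \<phi> g (xs ! l) = xs ! i then 1 else 0) else 0)"
    using l xs(1) by (intro sum.cong) (auto simp: nth_eq_iff_index_eq)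
  also have "\<dots> = (if \<phi> (g \<otimes> h) (xs ! j) = xs ! i then 1 else 0)"
    using l act_mult[OF g h x[OF j]] by simp
  finally show "(perm_mat \<phi> xs (g \<otimes> h) :: 'k mat) $$ (i, j) = (perm_mat \<phi> xs g * perm_mat \<phi> xs h) $$ (i, j)"
    using i j by (simp add: perm_mat_def)
qed (auto simp: perm_mat_def)

lemma (in finite_gset) perm_mat_one:
  assumes "distinct xs" "set xs = X"
  shows "(perm_mat \<phi> xs \<one> :: 'k::field mat) = 1\<^sub>m (length xs)"
  using assms act_one by (intro eq_matI) (auto simp: perm_mat_def nth_eq_iff_index_eq)

lemma (in finite_gset) perm_mat_in_mat_reps:
  assumes xs: "distinct xs" "set xs = X"
  shows "(perm_mat \<phi> xs :: 'a \<Rightarrow> 'k::field mat) \<in> mat_reps G"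
proof -
  let ?P = "perm_mat \<phi> xs :: 'a \<Rightarrow> 'k mat" and ?n = "length xs"
  have c: "?P g \<in> carrier_mat ?n ?n" for g by (simp add: perm_mat_def)
  have "?P \<in> hom G (GL TYPE('k) ?n)"
  proof (rule homI)
    fix g assume g: "g \<in> carrier G"
    have "?P (inv g) * ?P g = 1\<^sub>m ?n" "?P g * ?P (inv g) = 1\<^sub>m ?n"
      using g by (simp_all add: perm_mat_mult[OF xs, symmetric] perm_mat_one[OF xs])
    then show "?P g \<in> carrier (GL TYPE('k) ?n)" using c by (auto simp: GL_simps)
  next
    fix g h assume "g \<in> carrier G" "h \<in> carrier G"
    then show "?P (g \<otimes> h) = ?P g \<otimes>\<^bsub>GL TYPE('k) ?n\<^esub> ?P h"
      by (simp add: perm_mat_mult[OF xs] GL_simps)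
  qed
  then show ?thesis by (auto simp: mat_reps_def)
qed

lemma perm_space_simps [simp]:
  "carrier (perm_space F X) = {f. Poly_Mapping.keys f \<subseteq> X}"
  "zero (perm_space F X) = 0" "add (perm_space F X) = (+)"
  "module.smult (perm_space F X) = (\<lambda>c. Poly_Mapping.map ((*) c))"
  by (simp_all add: perm_space_def)

lemma lookup_map_scale: "Poly_Mapping.lookup (Poly_Mapping.map ((*) (c::'a::field)) f) x = c * Poly_Mapping.lookup f x"
  by (simp add: Poly_Mapping.map.rep_eq when_def)

lemma class_ring_field: "field (class_ring :: 'a::field ring)"
  using vec_vs[where ?'a = 'a] by (auto simp: vectorspace_def)

lemma vectorspace_perm_space: "vectorspace (class_ring :: 'a ring) (perm_space (F :: 'a::field itself) X)"
proof -
  have "Module.module (class_ring :: 'a ring) (perm_space F X)"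
  proof (rule Module.moduleI)
    show "cring (class_ring :: 'a ring)" using class_ring_field[where ?'a = 'a] by (simp add: field_def domain_def)
    show "abelian_group (perm_space F X)"
    proof (rule abelian_groupI)
      fix x assume "x \<in> carrier (perm_space F X)"
      then show "\<exists>y\<in>carrier (perm_space F X). y \<oplus>\<^bsub>perm_space F X\<^esub> x = \<zero>\<^bsub>perm_space F X\<^esub>"
        by (intro bexI[of _ "- x"]) auto
    qed (auto simp: add_ac dest!: subsetD[OF Poly_Mapping.keys_add])
  next
    fix c and f assume "f \<in> carrier (perm_space F X)"
    then show "c \<odot>\<^bsub>perm_space F X\<^esub> f \<in> carrier (perm_space F X)"
      by (auto simp: in_keys_iff lookup_map_scale subset_iff)
  qed (auto intro!: poly_mapping_eqI simp: lookup_add lookup_map_scale algebra_simps)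
  then show ?thesis using class_ring_field by (auto simp: vectorspace_def)
qed

lemma lookup_perm_act:
  assumes "finite X" "Poly_Mapping.keys f \<subseteq> X"
  shows "Poly_Mapping.lookup (perm_act \<phi> g f) y = (\<Sum>x\<in>X. if \<phi> g x = y then Poly_Mapping.lookup f x else 0)"
proof -
  have "Poly_Mapping.lookup (perm_act \<phi> g f) y =
      (\<Sum>x\<in>Poly_Mapping.keys f. if \<phi> g x = y then Poly_Mapping.lookup f x else 0)"
    by (simp add: perm_act_def lookup_sum lookup_single when_def)
  also have "\<dots> = (\<Sum>x\<in>X. if \<phi> g x = y then Poly_Mapping.lookup f x else 0)"
    using assms by (intro sum.mono_neutral_left) (auto simp: in_keys_iff)
  finally show ?thesis .
qed

lemma (in finite_gset) perm_act_closed: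
  assumes "g \<in> carrier G" "f \<in> carrier (perm_space F X)"
  shows "perm_act \<phi> g f \<in> carrier (perm_space F X)"
proof -
  have "Poly_Mapping.lookup (perm_act \<phi> g f) y = 0" if "y \<notin> X" for y
    using assms that act_closed by (subst lookup_perm_act[OF finite_X]) (auto intro!: sum.neutral)
  then show ?thesis by (auto simp: in_keys_iff)
qed

lemma (in finite_gset) perm_mat_iso_perm_space:
  fixes F :: "'k::field itself"
  assumes xs: "distinct xs" "set xs = X"
  defines "P \<equiv> perm_mat \<phi> xs :: 'a \<Rightarrow> 'k mat"
  shows "rep_iso G (mat_space G P) (mat_act P) (perm_space F X) (perm_act \<phi>)"
proof -
  let ?n = "length xs"
  define T :: "'k vec \<Rightarrow> 'x \<Rightarrow>\<^sub>0 'k"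
    where "T v = (\<Sum>i<?n. Poly_Mapping.single (xs ! i) (v $ i))" for v
  have deg: "mat_deg G P = ?n" by (simp add: mat_deg_def P_def perm_mat_def)
  have V: "carrier (mat_space G P) = carrier_vec ?n" "add (mat_space G P) = (+)"
      "module.smult (mat_space G P) = (\<cdot>\<^sub>v)"
    by (simp_all add: mat_space_def module_vec_simps deg)
  have lookup: "Poly_Mapping.lookup (T v) (xs ! i) = v $ i" if "i < ?n" for v i
    using that xs(1) by (simp add: T_def lookup_sum lookup_single when_def nth_eq_iff_index_eq)
  have keys: "Poly_Mapping.keys (T v) \<subseteq> X" for v
    using xs(2) by (auto simp: T_def lookup_sum lookup_single when_def in_keys_iff elim!: sum.not_neutral_contains_not_neutral split: if_splits)
  have eqI: "f = f'"
    if "Poly_Mapping.keys f \<subseteq> X" "Poly_Mapping.keys f' \<subseteq> X"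
      "\<And>i. i < ?n \<Longrightarrow> Poly_Mapping.lookup f (xs ! i) = Poly_Mapping.lookup f' (xs ! i)"
    for f f' :: "'x \<Rightarrow>\<^sub>0 'k"
  proof (rule poly_mapping_eqI)
    fix x show "Poly_Mapping.lookup f x = Poly_Mapping.lookup f' x"
    proof (cases "x \<in> X")
      case True
      then show ?thesis using that(3) xs(2) by (metis in_set_conv_nth)
    next
      case False
      then show ?thesis using that(1,2) by (metis in_keys_iff subsetD)
    qed
  qed
  have W: "x + y \<in> carrier (perm_space F X)" "Poly_Mapping.map ((*) c) x \<in> carrier (perm_space F X)"
    if "x \<in> carrier (perm_space F X)" "y \<in> carrier (perm_space F X)" for x y c
    using that Poly_Mapping.keys_add[of x y] by (auto simp: in_keys_iff lookup_map_scale subset_iff)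
  have "linear_map class_ring (mat_space G P) (perm_space F X) T"
  proof (rule linear_mapI)
    show "vectorspace class_ring (mat_space G P)" unfolding mat_space_def by (rule vec_vs)
    fix v w assume "v \<in> carrier (mat_space G P)" "w \<in> carrier (mat_space G P)"
    then show "T (v \<oplus>\<^bsub>mat_space G P\<^esub> w) = T v \<oplus>\<^bsub>perm_space F X\<^esub> T w"
      using W(1)[of "T v" "T w"] keys by (intro eqI) (auto simp: V lookup lookup_add)
  next
    fix c v assume "v \<in> carrier (mat_space G P)"
    then show "T (c \<odot>\<^bsub>mat_space G P\<^esub> v) = c \<odot>\<^bsub>perm_space F X\<^esub> T v"
      using W(2)[of "T v" "T v" c] keys by (intro eqI) (auto simp: V lookup lookup_map_scale)
  qed (use keys vectorspace_perm_space in auto)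
  moreover have "bij_betw T (carrier (mat_space G P)) (carrier (perm_space F X))"
  proof (rule bij_betw_byWitness[where f' = "\<lambda>f. vec ?n (\<lambda>i. Poly_Mapping.lookup f (xs ! i))"])
    show "\<forall>v\<in>carrier (mat_space G P). vec ?n (\<lambda>i. Poly_Mapping.lookup (T v) (xs ! i)) = v"
      by (auto simp: V lookup intro!: eq_vecI)
    show "\<forall>f\<in>carrier (perm_space F X). T (vec ?n (\<lambda>i. Poly_Mapping.lookup f (xs ! i))) = f"
      by (auto intro!: eqI keys simp: lookup)
  qed (use keys in \<open>auto simp: V\<close>)
  moreover have "T (mat_act P g v) = perm_act \<phi> g (T v)"
    if g: "g \<in> carrier G" and v: "v \<in> carrier (mat_space G P)" for g v
  proof (rule eqI)
    show "Poly_Mapping.keys (perm_act \<phi> g (T v)) \<subseteq> X"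
      using perm_act_closed[OF g, of "T v" F] keys by simp
    have dim: "dim_vec v = ?n" using v V(1) by auto
    fix i assume i: "i < ?n"
    have "Poly_Mapping.lookup (T (mat_act P g v)) (xs ! i) =
        (\<Sum>j<?n. (if \<phi> g (xs ! j) = xs ! i then 1 else 0) * v $ j)"
      using i by (simp add: lookup mat_act_def P_def perm_mat_def dim scalar_prod_def lessThan_atLeast0)
    also have "\<dots> = (\<Sum>j<?n. if \<phi> g (xs ! j) = xs ! i then Poly_Mapping.lookup (T v) (xs ! j) else 0)"
      by (intro sum.cong) (auto simp: lookup)
    also have "\<dots> = (\<Sum>x\<in>X. if \<phi> g x = xs ! i then Poly_Mapping.lookup (T v) x else 0)"
      using bij_betw_nth[OF xs(1) refl xs(2)[symmetric]]
      by (rule sum.reindex_bij_betw)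
    also have "\<dots> = Poly_Mapping.lookup (perm_act \<phi> g (T v)) (xs ! i)"
      by (rule lookup_perm_act[OF finite_X keys, symmetric])
    finally show "Poly_Mapping.lookup (T (mat_act P g v)) (xs ! i) =
        Poly_Mapping.lookup (perm_act \<phi> g (T v)) (xs ! i)" .
  qed (rule keys)
  ultimately show ?thesis unfolding rep_iso_def by blast
qed

text \<open>
  It is enough to know a matrix representation \<open>N\<close> on the carrier of \<open>G\<close>.  This allows to name the
  class of a \<open>G\<close>-set by the very element of the free group that occurs in a relation, such as a
  direct sum or the trivial representation.
\<close>

lemma (in finite_gset) perm_class_eq_coset:
  fixes F :: "'k::field itself" and N :: "'a \<Rightarrow> 'k mat"
  assumes xs: "distinct xs" "set xs = X"
    and N: "\<And>g. g \<in> carrier G \<Longrightarrow> perm_mat \<phi> xs g = N g"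
  shows "perm_class F G X \<phi> = rep_coset F G (frag_of N)"
  unfolding perm_class_def
  using mat_reps_cong[OF group_axioms, of "perm_mat \<phi> xs" N, OF N]
    perm_mat_in_mat_reps[OF xs] perm_mat_iso_perm_space[OF xs, of F]
  by (intro rep_class_eq_coset group_axioms) auto

text \<open>
  Transporting an enumeration of \<open>X\<close> along an equivariant bijection leaves the permutation matrices
  unchanged.
\<close>

lemma perm_class_cong_bij:
  fixes F :: "'k::field itself"
  assumes X: "finite_gset G X \<phi>" and Y: "finite_gset G Y \<psi>" and f: "bij_betw f X Y"
    and eq: "\<And>g x. g \<in> carrier G \<Longrightarrow> x \<in> X \<Longrightarrow> f (\<phi> g x) = \<psi> g (f x)"
  shows "perm_class F G X \<phi> = perm_class F G Y \<psi>"
proof -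
  interpret X: finite_gset G X \<phi> by (rule X)
  obtain xs where xs: "distinct xs" "set xs = X" using finite_distinct_list[OF X.finite_X] by blast
  have ys: "distinct (map f xs)" "set (map f xs) = Y"
    using xs f by (auto simp: distinct_map bij_betw_def)
  have "perm_mat \<psi> (map f xs) g = (perm_mat \<phi> xs g :: 'k mat)" if g: "g \<in> carrier G" for g
  proof (rule eq_matI)
    fix i j assume "i < dim_row (perm_mat \<phi> xs g :: 'k mat)" "j < dim_col (perm_mat \<phi> xs g :: 'k mat)"
    then have ij: "i < length xs" "j < length xs" by (simp_all add: perm_mat_def)
    then have x: "xs ! i \<in> X" "xs ! j \<in> X" using xs by auto
    have "\<psi> g (f (xs ! j)) = f (xs ! i) \<longleftrightarrow> \<phi> g (xs ! j) = xs ! i"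
      using f x X.act_closed[OF g x(2)] unfolding eq[OF g x(2), symmetric]
      by (auto simp: bij_betw_def inj_on_def)
    then show "(perm_mat \<psi> (map f xs) g :: 'k mat) $$ (i, j) = perm_mat \<phi> xs g $$ (i, j)"
      using ij by (simp add: perm_mat_def)
  qed (simp_all add: perm_mat_def)
  from finite_gset.perm_class_eq_coset[OF Y ys this] X.perm_class_eq_coset[OF xs refl]
  show ?thesis by metis
qed

lemma perm_mat_append:
  assumes X: "finite_gset G (set xs) \<phi>" and Y: "finite_gset G (set ys) \<phi>"
    and disj: "set xs \<inter> set ys = {}" and g: "g \<in> carrier G"
  shows "perm_mat \<phi> (xs @ ys) g = (rep_sum (perm_mat \<phi> xs) (perm_mat \<phi> ys) g :: 'k::field mat)"
proof (rule eq_matI)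
  let ?R = "rep_sum (perm_mat \<phi> xs) (perm_mat \<phi> ys) g :: 'k mat"
  let ?n = "length xs" and ?m = "length ys"
  have R: "?R = four_block_mat (perm_mat \<phi> xs g) (0\<^sub>m ?n ?m) (0\<^sub>m ?m ?n) (perm_mat \<phi> ys g)"
    using diag_block_mat_last[of "[perm_mat \<phi> xs g]" "perm_mat \<phi> ys g"]
    by (simp add: rep_sum_def Let_def perm_mat_def del: diag_block_mat.simps)
  have zx: "\<phi> g (xs ! k) \<in> set xs" if "k < ?n" for k
    using that finite_gset.act_closed[OF X g] by simp
  have zy: "\<phi> g (ys ! k) \<in> set ys" if "k < ?m" for k
    using that finite_gset.act_closed[OF Y g] by simp
  show "dim_row (perm_mat \<phi> (xs @ ys) g :: 'k mat) = dim_row ?R" "dim_col (perm_mat \<phi> (xs @ ys) g :: 'k mat) = dim_col ?R"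
    unfolding R by (simp_all add: perm_mat_def)
  fix i j assume "i < dim_row ?R" "j < dim_col ?R"
  then have ij: "i < ?n + ?m" "j < ?n + ?m" unfolding R by (simp_all add: perm_mat_def)
  have ne: "\<phi> g (xs ! k) \<noteq> ys ! l" "\<phi> g (ys ! l) \<noteq> xs ! k" if "k < ?n" "l < ?m" for k l
    using zx[OF that(1)] zy[OF that(2)] that disj nth_mem by (metis disjoint_iff)+
  show "(perm_mat \<phi> (xs @ ys) g :: 'k mat) $$ (i, j) = ?R $$ (i, j)"
    unfolding R using ij ne by (auto simp: perm_mat_def nth_append)
qed

text \<open>
  The concatenated enumeration has the block diagonal permutation matrices, so the relation for direct sums applies.
\<close>

lemma perm_class_disjoint_union:
  fixes F :: "'k::field itself"
  assumes X: "finite_gset G X \<phi>" and Y: "finite_gset G Y \<phi>" and disj: "X \<inter> Y = {}"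
  shows "perm_class F G (X \<union> Y) \<phi> = perm_class F G X \<phi> \<oplus>\<^bsub>rep_ring F G\<^esub> perm_class F G Y \<phi>"
proof -
  interpret X: finite_gset G X \<phi> by (rule X)
  interpret Y: finite_gset G Y \<phi> by (rule Y)
  have XY: "finite_gset G (X \<union> Y) \<phi>"
    by unfold_locales (auto simp: X.finite_X Y.finite_X X.act_closed Y.act_closed X.act_one Y.act_one X.act_mult Y.act_mult)
  obtain xs where xs: "distinct xs" "set xs = X" using finite_distinct_list[OF X.finite_X] by blast
  obtain ys where ys: "distinct ys" "set ys = Y" using finite_distinct_list[OF Y.finite_X] by blast
  define M N :: "'a \<Rightarrow> 'k mat" where "M = perm_mat \<phi> xs" and "N = perm_mat \<phi> ys"
  have M: "M \<in> mat_reps G" and N: "N \<in> mat_reps G"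
    unfolding M_def N_def by (rule X.perm_mat_in_mat_reps[OF xs] Y.perm_mat_in_mat_reps[OF ys])+
  have zs: "distinct (xs @ ys)" "set (xs @ ys) = X \<union> Y" using xs ys disj by auto
  have app: "perm_mat \<phi> (xs @ ys) g = rep_sum M N g" if "g \<in> carrier G" for g
    unfolding M_def N_def using that X Y xs ys disj by (intro perm_mat_append) auto
  have S: "rep_sum M N \<in> mat_reps G"
    by (rule iffD1[OF mat_reps_cong(1)[OF X.group_axioms app] finite_gset.perm_mat_in_mat_reps[OF XY zs]])
  define r where "r = frag_of (rep_sum M N) - (frag_of M + frag_of N)"
  have "r \<in> rep_relations F G" 
    unfolding r_def rep_relations_def by (intro UnI2 CollectI exI[of _ M] exI[of _ N] conjI refl M N)
  moreover have "Poly_Mapping.keys r \<subseteq> mat_reps G"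
    using keys_diff[of "frag_of (rep_sum M N)" "frag_of M + frag_of N"]
      Poly_Mapping.keys_add[of "frag_of M" "frag_of N"] S M N
    unfolding r_def by (auto simp: keys_frag_of)
  ultimately have r: "r \<in> rep_ideal F G" "- r \<in> rep_ideal F G" by (rule rep_ideal_relation)+
  have "perm_class F G (X \<union> Y) \<phi> = rep_coset F G (frag_of (rep_sum M N))"
    by (rule finite_gset.perm_class_eq_coset[OF XY zs app])
  also have "\<dots> = rep_coset F G (frag_of M + frag_of N)"
    by (rule rep_coset_eqI) (use r in \<open>simp_all add: r_def\<close>)
  also have "\<dots> = perm_class F G X \<phi> \<oplus>\<^bsub>rep_ring F G\<^esub> perm_class F G Y \<phi>"
    unfolding M_def N_def X.perm_class_eq_coset[OF xs refl] Y.perm_class_eq_coset[OF ys refl] rep_ring_simps ..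
  finally show ?thesis .
qed

lemma perm_class_fixed_point:
  assumes "finite_gset G {x} \<phi>"
  shows "perm_class F G {x} \<phi> = \<one>\<^bsub>rep_ring F G\<^esub>"
  unfolding rep_ring_simps
proof (rule finite_gset.perm_class_eq_coset[OF assms])
  fix g assume "g \<in> carrier G"
  then have "\<phi> g x = x" using finite_gset.act_closed[OF assms] by blast
  then show "perm_mat \<phi> [x] g = trivial_rep g"
    by (intro eq_matI) (auto simp: perm_mat_def trivial_rep_def)
qed auto

text \<open>
  The empty set is the disjoint union of two copies of itself, so its class \<open>p\<close> satisfies \<open>p + p = p\<close>.
\<close>

lemma perm_class_empty:
  fixes F :: "'k::field itself"
  assumes "group G"
  shows "perm_class F G {} \<phi> = \<zero>\<^bsub>rep_ring F G\<^esub>"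
proof -
  have E: "finite_gset G {} \<phi>" using assms by (auto simp: finite_gset_def finite_gset_axioms_def)
  define p where "p = frag_of (perm_mat \<phi> [] :: _ \<Rightarrow> 'k mat)"
  have c: "perm_class F G {} \<phi> = rep_coset F G p"
    unfolding p_def by (rule finite_gset.perm_class_eq_coset[OF E]) auto
  then have eq: "rep_coset F G p = rep_coset F G (p + p)"
    using perm_class_disjoint_union[OF E E, of F] by (simp add: rep_ring_simps)
  have "p - p \<in> rep_ideal F G" "p + p - (p + p) \<in> rep_ideal F G" by (simp_all add: rep_ideal_0)
  then have "p \<in> rep_coset F G (p + p)" "p + p \<in> rep_coset F G p"
    using eq by (simp_all only: mem_rep_coset[symmetric])
  then have "p \<in> rep_ideal F G" "- p \<in> rep_ideal F G" by (simp_all add: mem_rep_coset)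
  then show ?thesis unfolding c rep_ring_simps by (intro rep_coset_eqI) simp_all
qed

lemma finite_gset_times:
  assumes "finite_gset G Y \<phi>" "finite K"
  shows "finite_gset G (K \<times> Y) (\<lambda>g (k, y). (k, \<phi> g y))"
proof -
  interpret finite_gset G Y \<phi> by (rule assms(1))
  show ?thesis
    by unfold_locales (auto simp: finite_X assms act_closed act_one act_mult)
qed

text \<open>When \<open>G\<close> acts trivially on \<open>K\<close>, the product \<open>K \<times> Y\<close> is a disjoint union of copies of \<open>Y\<close>.\<close>

lemma perm_class_times:
  assumes Y: "finite_gset G Y \<phi>" and K: "finite K"
  shows "perm_class F G (K \<times> Y) (\<lambda>g (k, y). (k, \<phi> g y)) = add_pow (rep_ring F G) (card K) (perm_class F G Y \<phi>)"
    (is "perm_class F G _ ?\<psi> = _")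
  using K
proof (induction K rule: finite_induct)
  case empty
  interpret finite_gset G Y \<phi> by (rule Y)
  show ?case by (simp add: perm_class_empty[OF group_axioms] add_pow_def nat_pow_def)
next
  case (insert k K)
  have fib: "finite_gset G ({k} \<times> Y) ?\<psi>" by (rule finite_gset_times[OF Y]) simp
  have "perm_class F G (K \<times> Y \<union> {k} \<times> Y) ?\<psi> =
      perm_class F G (K \<times> Y) ?\<psi> \<oplus>\<^bsub>rep_ring F G\<^esub> perm_class F G ({k} \<times> Y) ?\<psi>"
    using insert.hyps by (intro perm_class_disjoint_union finite_gset_times[OF Y] fib) auto
  also have "perm_class F G ({k} \<times> Y) ?\<psi> = perm_class F G Y \<phi>"
    by (rule perm_class_cong_bij[OF fib Y, of snd]) (auto simp: bij_betw_def inj_on_def)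
  also have "K \<times> Y \<union> {k} \<times> Y = insert k K \<times> Y" by auto
  finally show ?case using insert by (simp add: add_pow_def nat_pow_def)
qed

section \<open>The action of the symmetric group on polynomials and points\<close>

lemma lookup_map_key_bij:
  "bij f \<Longrightarrow> Poly_Mapping.lookup (Poly_Mapping.map_key f p) x = Poly_Mapping.lookup p (f x)"
  by (simp add: map_key.rep_eq bij_is_inj)

lemma lookup_poly_act:
  assumes "bij \<sigma>"
  shows "Poly_Mapping.lookup (poly_act \<sigma> p) m = Poly_Mapping.lookup p (Poly_Mapping.map_key \<sigma> m)"
  using inj_map_key[OF assms] by (simp add: poly_act_def map_key.rep_eq)

lemma map_key_inv:
  assumes "bij \<sigma>"
  shows "Poly_Mapping.map_key \<sigma> (Poly_Mapping.map_key (inv' \<sigma>) m) = m"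
    and "Poly_Mapping.map_key (inv' \<sigma>) (Poly_Mapping.map_key \<sigma> m) = m"
  using assms bij_imp_bij_inv[OF assms]
  by (auto intro!: poly_mapping_eqI simp: lookup_map_key_bij bij_is_inj bij_is_surj surj_f_inv_f)

lemma bij_map_key:
  assumes "bij (\<sigma> :: nat \<Rightarrow> nat)"
  shows "bij (Poly_Mapping.map_key \<sigma> :: (nat \<Rightarrow>\<^sub>0 nat) \<Rightarrow> _)"
  by (rule o_bij[of "Poly_Mapping.map_key (inv' \<sigma>)"]) (simp_all add: fun_eq_iff map_key_inv[OF assms])

lemma poly_act_inv:
  assumes "bij \<sigma>"
  shows "poly_act \<sigma> (poly_act (inv' \<sigma>) p) = p"
  using assms bij_imp_bij_inv[OF assms]
  by (intro poly_mapping_eqI) (simp add: lookup_poly_act map_key_inv)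

lemma monomial_eval_map_key:
  assumes "bij \<sigma>"
  shows "monomial_eval (a \<circ> \<sigma>) (Poly_Mapping.map_key \<sigma> m) = monomial_eval a m"
proof -
  have "bij_betw \<sigma> (\<sigma> -` Poly_Mapping.keys m) (Poly_Mapping.keys m)"
    using assms by (auto simp: bij_betw_def bij_def inj_on_def surj_image_vimage_eq)
  then show ?thesis
    unfolding monomial_eval_def keys_map_key[OF bij_is_inj[OF assms]]
    by (subst prod.reindex_bij_betw[symmetric]) (auto simp: lookup_map_key_bij[OF assms])
qed

text \<open>
  Since \<open>\<sigma>\<close> substitutes \<open>x\<^bsub>\<sigma>(i)\<^esub>\<close> for \<open>x\<^sub>i\<close>, evaluating \<open>\<sigma> p\<close> amounts to permuting the
  coordinates.  As the ideal is determined by its zeros, this formula describes the action on the quotient without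
  following what \<open>\<sigma>\<close> does to generators or idempotents.
\<close>

lemma eval_poly_act:
  assumes "bij \<sigma>"
  shows "eval a (poly_act \<sigma> p) = eval (a \<circ> \<sigma>) p"
proof -
  let ?h = "Poly_Mapping.map_key \<sigma> :: (nat \<Rightarrow>\<^sub>0 nat) \<Rightarrow> _"
  have keys: "Poly_Mapping.keys (poly_act \<sigma> p) = ?h -` Poly_Mapping.keys p"
    unfolding poly_act_def by (rule keys_map_key[OF inj_map_key[OF assms]])
  have "bij_betw ?h (?h -` Poly_Mapping.keys p) (Poly_Mapping.keys p)"
    using bij_map_key[OF assms] by (auto simp: bij_betw_def bij_def inj_on_def surj_image_vimage_eq)
  then show ?thesis
    unfolding eval_def keys
    by (subst (2) sum.reindex_bij_betw[symmetric])
       (auto simp: lookup_poly_act[OF assms] monomial_eval_map_key[OF assms])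
qed

lemma poly_act_closed:
  assumes \<sigma>: "\<sigma> permutes {1..n}" and p: "p \<in> carrier (poly_ring F n)"
  shows "poly_act \<sigma> p \<in> carrier (poly_ring F n)"
  unfolding poly_ring_def
proof (clarsimp simp del: atLeastAtMost_iff)
  fix m i assume m: "m \<in> Poly_Mapping.keys (poly_act \<sigma> p)" and i: "i \<in> Poly_Mapping.keys m"
  have bij: "bij \<sigma>" using \<sigma> by (rule permutes_bij)
  have "Poly_Mapping.map_key \<sigma> m \<in> Poly_Mapping.keys p"
    using m by (simp add: in_keys_iff lookup_poly_act[OF bij])
  then have "Poly_Mapping.keys (Poly_Mapping.map_key \<sigma> m) \<subseteq> {1..n}"
    using p by (simp add: poly_ring_def)
  moreover have "inv' \<sigma> i \<in> Poly_Mapping.keys (Poly_Mapping.map_key \<sigma> m)"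
    using i by (simp add: in_keys_iff lookup_map_key_bij[OF bij] permutes_inverses(1)[OF \<sigma>])
  ultimately show "i \<in> {1..n}"
    using permutes_in_image[OF permutes_inv[OF \<sigma>]] by blast
qed

text \<open>
  The inverse makes this a left action.  It matches the action on subsets: \<open>\<sigma>\<close> moves the sign pattern
  \<open>A\<close> to its image (\<open>sign_point_permute\<close>).
\<close>

definition point_act :: "(nat \<Rightarrow> nat) \<Rightarrow> (nat \<Rightarrow> 'a) \<Rightarrow> nat \<Rightarrow> 'a"
  where "point_act \<sigma> a = a \<circ> inv' \<sigma>"

lemma comp_permutes_PiE:
  assumes "\<tau> permutes {1..n}" "a \<in> {1..n} \<rightarrow>\<^sub>E UNIV"
  shows "a \<circ> \<tau> \<in> {1..n} \<rightarrow>\<^sub>E UNIV"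
proof (rule PiE_I)
  fix i assume i: "i \<notin> {1..n}"
  have "\<tau> i = i" using permutes_not_in[OF assms(1) i] .
  then show "(a \<circ> \<tau>) i = undefined" using PiE_arb[OF assms(2) i] by simp
qed simp

lemma origin_comp_permutes:
  assumes "\<tau> permutes {1..n}"
  shows "(\<lambda>i\<in>{1..n}. c) \<circ> \<tau> = (\<lambda>i\<in>{1..n}. c)"
  using permutes_in_image[OF assms] permutes_not_in[OF assms] by (auto simp: fun_eq_iff)

lemma zeros_comp_permutes:
  assumes n: "n \<ge> 2" and \<tau>: "\<tau> permutes {1..n}" and a: "a \<in> zeros n (I_gens F n)"
  shows "a \<circ> \<tau> \<in> zeros n (I_gens F n)"
proof (cases "n = 2")
  case True
  then show ?thesis
    using a origin_comp_permutes[OF \<tau>, of 0] by (simp add: zeros_I_gens_2)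
next
  case False
  then have n: "n \<ge> 3" using n by simp
  have "(\<Prod>j\<in>{1..n}-{i}. a (\<tau> j)) = a (\<tau> i)" if i: "i \<in> {1..n}" for i
  proof -
    have "\<tau> ` ({1..n} - {i}) = {1..n} - {\<tau> i}"
      using permutes_image[OF \<tau>] permutes_inj[OF \<tau>] by (simp add: image_set_diff)
    then have "bij_betw \<tau> ({1..n} - {i}) ({1..n} - {\<tau> i})"
      using permutes_inj[OF \<tau>] by (auto simp: bij_betw_def intro: inj_on_subset)
    then have "(\<Prod>j\<in>{1..n}-{i}. a (\<tau> j)) = (\<Prod>j\<in>{1..n}-{\<tau> i}. a j)"
      by (rule prod.reindex_bij_betw)
    also have "\<dots> = a (\<tau> i)"
      using a permutes_in_image[OF \<tau>, of i] i unfolding zeros_I_gens[OF n] by blast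
    finally show ?thesis .
  qed
  then show ?thesis
    using a comp_permutes_PiE[OF \<tau>, of a] unfolding zeros_I_gens[OF n] by simp
qed

lemma finite_gset_point_act:
  assumes "finite X" and "\<And>\<sigma> a. \<sigma> permutes {1..n} \<Longrightarrow> a \<in> X \<Longrightarrow> a \<circ> \<sigma> \<in> X"
  shows "finite_gset (sym_group n) X point_act"
proof -
  interpret group "sym_group n" by (rule sym_group_is_group)
  show ?thesis
  proof
    fix g h and a :: "nat \<Rightarrow> 'a"
    assume "g \<in> carrier (sym_group n)" "h \<in> carrier (sym_group n)"
    then have "bij g" "bij h" by (auto simp: sym_group_carrier permutes_bij)
    then show "point_act (g \<otimes>\<^bsub>sym_group n\<^esub> h) a = point_act g (point_act h a)"
      by (simp add: point_act_def sym_group_mult o_inv_distrib comp_assoc)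
  qed (use assms in \<open>auto simp: point_act_def sym_group_carrier sym_group_one permutes_inv\<close>)
qed

lemma finite_gset_subsets:
  assumes "\<X> \<subseteq> Pow {1..n}"
    and "\<And>\<sigma> A. \<sigma> permutes {1..n} \<Longrightarrow> A \<in> \<X> \<Longrightarrow> \<sigma> ` A \<in> \<X>"
  shows "finite_gset (sym_group n) \<X> (`)"
proof -
  interpret group "sym_group n" by (rule sym_group_is_group)
  show ?thesis
  proof
    show "finite \<X>" using assms(1) by (rule finite_subset) simp
  qed (use assms(2) in \<open>auto simp: sym_group_carrier sym_group_one sym_group_mult image_comp\<close>)
qed

section \<open>The quotient as a permutation representation\<close>

lemma quot_space_simps:
  "carrier (quot_space F n) = carrier (poly_ring F n Quot I_ideal F n)"
  "add (quot_space F n) = add (poly_ring F n Quot I_ideal F n)"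
  "zero (quot_space F n) = zero (poly_ring F n Quot I_ideal F n)"
  "module.smult (quot_space F n) = (\<lambda>c. monoid.mult (poly_ring F n Quot I_ideal F n) (I_ideal F n +>\<^bsub>poly_ring F n\<^esub> Const c))"
  by (simp_all add: quot_space_def Let_def)

lemma vectorspace_quot_space:
  fixes F :: "'a::field itself"
  assumes "n \<ge> 2"
  shows "vectorspace class_ring (quot_space F n)"
proof -
  let ?R = "poly_ring F n" and ?I = "I_ideal F n"
  let ?Q = "?R Quot ?I"
  interpret R: cring ?R by (rule poly_ring_cring)
  interpret I: ideal ?I ?R
    unfolding I_ideal_def by (rule R.genideal_ideal[OF I_gens_subset[OF assms]])
  interpret Q: cring ?Q by (rule I.quotient_is_cring[OF R.is_cring])
  note hom = I.rcos_ring_hom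
  have hc: "?I +>\<^bsub>?R\<^esub> Const c \<in> carrier ?Q" for c
    by (rule ring_hom_closed[OF hom]) simp
  have h1: "?I +>\<^bsub>?R\<^esub> Const (a + b) = (?I +>\<^bsub>?R\<^esub> Const a) \<oplus>\<^bsub>?Q\<^esub> (?I +>\<^bsub>?R\<^esub> Const b)" for a b
    using ring_hom_add[OF hom, of "Const a" "Const b"] by (simp add: Const_simps)
  have h2: "?I +>\<^bsub>?R\<^esub> Const (a * b) = (?I +>\<^bsub>?R\<^esub> Const a) \<otimes>\<^bsub>?Q\<^esub> (?I +>\<^bsub>?R\<^esub> Const b)" for a b
    using ring_hom_mult[OF hom, of "Const a" "Const b"] by (simp add: Const_simps)
  have h3: "?I +>\<^bsub>?R\<^esub> Const 1 = \<one>\<^bsub>?Q\<^esub>"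
    using ring_hom_one[OF hom] by (simp add: Const_simps)
  have ag: "abelian_group (quot_space F n)"
  proof (rule abelian_groupI)
    fix x assume "x \<in> carrier (quot_space F n)"
    then show "\<exists>y\<in>carrier (quot_space F n). y \<oplus>\<^bsub>quot_space F n\<^esub> x = \<zero>\<^bsub>quot_space F n\<^esub>"
      by (intro bexI[of _ "\<ominus>\<^bsub>?Q\<^esub> x"]) (simp_all add: quot_space_simps Q.l_neg)
  qed (simp_all add: quot_space_simps Q.a_ac)
  have cr: "cring (class_ring :: 'a ring)"
    using class_ring_field[where ?'a = 'a] by (simp add: field_def domain_def)
  have "Module.module class_ring (quot_space F n)"
  proof (rule Module.moduleI[OF cr ag])
    fix x assume "x \<in> carrier (quot_space F n)"
    then show "\<one>\<^bsub>class_ring\<^esub> \<odot>\<^bsub>quot_space F n\<^esub> x = x"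
      by (simp add: quot_space_simps h3)
  qed (simp_all add: quot_space_simps hc h1 h2 Q.l_distr Q.r_distr Q.m_assoc)
  then show ?thesis using class_ring_field by (auto simp: vectorspace_def)
qed

text \<open>
  A formal combination \<open>f\<close> of zeros is sent to the set of all polynomials whose value at each zero \<open>a\<close> is
  the coefficient of \<open>a\<close> in \<open>f\<close>.  This set is a coset of the ideal: it is nonempty by interpolation, and two
  interpolants differ by a polynomial that vanishes at the zeros.  Defining the map by values instead of
  by chosen representatives makes its equivariance immediate.
\<close>

lemma perm_space_zeros_iso_quot_space:
  fixes F :: "'a::{alg_closed_field, field_char_0} itself"
  assumes n: "n \<ge> 2"
  shows "rep_iso (sym_group n) (perm_space F (zeros n (I_gens F n))) (perm_act point_act)
    (quot_space F n) quot_act"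
proof -
  obtain Z where "split_ideal F n (I_gens F n) Z" using I_is_split_ideal[OF n, of F] by blast
  then interpret split_ideal F n "I_gens F n" Z .
  let ?X = "zeros n (I_gens F n)"
  have J: "I_ideal F n = J" by (simp add: I_ideal_def)
  note Q = quot_space_simps[of F n, unfolded J]
  note hom = J.rcos_ring_hom
  define T where "T f = {p \<in> carrier R. \<forall>a\<in>?X. eval a p = Poly_Mapping.lookup f a}" for f
  have T_eq: "T f = J +>\<^bsub>R\<^esub> p"
    if p: "p \<in> carrier R" "\<forall>a\<in>?X. eval a p = Poly_Mapping.lookup f a" for f p
  proof (rule Set.set_eqI)
    fix q
    have "q \<in> J +>\<^bsub>R\<^esub> p \<longleftrightarrow> q - p \<in> J"
    proof
      assume "q \<in> J +>\<^bsub>R\<^esub> p"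
      then show "q - p \<in> J" by (auto simp: a_r_coset_def')
    next
      assume "q - p \<in> J"
      then show "q \<in> J +>\<^bsub>R\<^esub> p" by (force simp: a_r_coset_def')
    qed
    also have "\<dots> \<longleftrightarrow> q \<in> carrier R \<and> (\<forall>a\<in>?X. eval a q = eval a p)"
    proof (cases "q \<in> carrier R")
      case True
      then show ?thesis using in_ideal_iff_vanishes[OF poly_ring_closed(2)[OF True p(1)]] by (simp add: eval_diff)
    next
      case False
      have "q = (q - p) + p" by simp
      then show ?thesis using False J_closed(1)[of "q - p"] poly_ring_closed(1)[OF _ p(1), of "q - p"] by metis
    qed
    finally show "q \<in> T f \<longleftrightarrow> q \<in> J +>\<^bsub>R\<^esub> p" using p(2) by (simp add: T_def)
  qed
  have T_ex: "\<exists>p\<in>carrier R. \<forall>a\<in>?X. eval a p = Poly_Mapping.lookup f a" for f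
    using interpolation_on_zeros[of "Poly_Mapping.lookup f"] .
  have "linear_map class_ring (perm_space F ?X) (quot_space F n) T"
  proof (rule linear_mapI)
    show "vectorspace class_ring (perm_space F ?X)" by (rule vectorspace_perm_space)
    show "vectorspace class_ring (quot_space F n)" by (rule vectorspace_quot_space[OF n])
    show "T \<in> carrier (perm_space F ?X) \<rightarrow> carrier (quot_space F n)"
    proof
      fix f obtain p where "p \<in> carrier R" "\<forall>a\<in>?X. eval a p = Poly_Mapping.lookup f a"
        using T_ex by blast
      then show "T f \<in> carrier (quot_space F n)"
        using ring_hom_closed[OF hom] T_eq by (simp add: Q)
    qed
    fix f g :: "(nat \<Rightarrow> 'a) \<Rightarrow>\<^sub>0 'a"
    obtain p where p: "p \<in> carrier R" "\<forall>a\<in>?X. eval a p = Poly_Mapping.lookup f a" using T_ex by blast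
    obtain q where q: "q \<in> carrier R" "\<forall>a\<in>?X. eval a q = Poly_Mapping.lookup g a" using T_ex by blast
    have "T (f + g) = J +>\<^bsub>R\<^esub> (p + q)"
      using p q by (intro T_eq) (auto simp: eval_add lookup_add)
    then show "T (f \<oplus>\<^bsub>perm_space F ?X\<^esub> g) = T f \<oplus>\<^bsub>quot_space F n\<^esub> T g"
      using ring_hom_add[OF hom p(1) q(1)] by (simp add: Q T_eq[OF p] T_eq[OF q])
  next
    fix c and f :: "(nat \<Rightarrow> 'a) \<Rightarrow>\<^sub>0 'a"
    obtain p where p: "p \<in> carrier R" "\<forall>a\<in>?X. eval a p = Poly_Mapping.lookup f a" using T_ex by blast
    have "T (Poly_Mapping.map ((*) c) f) = J +>\<^bsub>R\<^esub> (Const c * p)"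
      using p by (intro T_eq) (auto simp: eval_mult lookup_map_scale)
    then show "T (c \<odot>\<^bsub>perm_space F ?X\<^esub> f) = c \<odot>\<^bsub>quot_space F n\<^esub> T f"
      using ring_hom_mult[OF hom, of "Const c" p] p(1) by (simp add: Q T_eq[OF p])
  qed
  moreover have "bij_betw T (carrier (perm_space F ?X)) (carrier (quot_space F n))"
  proof (rule bij_betwI')
    fix f g assume fg: "f \<in> carrier (perm_space F ?X)" "g \<in> carrier (perm_space F ?X)"
    show "T f = T g \<longleftrightarrow> f = g"
    proof
      assume eq: "T f = T g"
      obtain p where p: "p \<in> carrier R" "\<forall>a\<in>?X. eval a p = Poly_Mapping.lookup f a" using T_ex by blast
      then have "p \<in> T g" unfolding eq[symmetric] by (simp add: T_def)
      then have on: "Poly_Mapping.lookup f a = Poly_Mapping.lookup g a" if "a \<in> ?X" for a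
        using p that by (simp add: T_def)
      show "f = g"
      proof (rule poly_mapping_eqI)
        fix a show "Poly_Mapping.lookup f a = Poly_Mapping.lookup g a"
        proof (cases "a \<in> ?X")
          case False
          then have "a \<notin> Poly_Mapping.keys f" "a \<notin> Poly_Mapping.keys g" using fg by auto
          then show ?thesis by (simp add: in_keys_iff)
        qed (rule on)
      qed
    qed simp
  next
    fix f :: "(nat \<Rightarrow> 'a) \<Rightarrow>\<^sub>0 'a"
    obtain p where "p \<in> carrier R" "\<forall>a\<in>?X. eval a p = Poly_Mapping.lookup f a"
      using T_ex by blast
    then show "T f \<in> carrier (quot_space F n)"
      using ring_hom_closed[OF hom] T_eq by (simp add: Q)
  next
    fix C assume "C \<in> carrier (quot_space F n)"
    then obtain p where p: "p \<in> carrier R" "C = J +>\<^bsub>R\<^esub> p"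
      by (auto simp: Q FactRing_def A_RCOSETS_def')
    define f where "f = (\<Sum>a\<in>?X. Poly_Mapping.single a (eval a p))"
    have lookup: "Poly_Mapping.lookup f a = (if a \<in> ?X then eval a p else 0)" for a
      using finite_zeros by (simp add: f_def lookup_sum lookup_single when_def)
    have "C = T f" using T_eq[OF p(1), of f] p(2) by (simp add: lookup)
    moreover have "f \<in> carrier (perm_space F ?X)" by (auto simp: in_keys_iff lookup split: if_splits)
    ultimately show "\<exists>f\<in>carrier (perm_space F ?X). C = T f" by blast
  qed
  moreover have "T (perm_act point_act \<sigma> f) = quot_act \<sigma> (T f)"
    if "\<sigma> \<in> carrier (sym_group n)" and f: "f \<in> carrier (perm_space F ?X)" for \<sigma> f
  proof -
    have \<sigma>: "\<sigma> permutes {1..n}" using that(1) by (simp add: sym_group_carrier)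
    have bij: "bij \<sigma>" using \<sigma> by (rule permutes_bij)
    have lookup: "Poly_Mapping.lookup (perm_act point_act \<sigma> f) a = Poly_Mapping.lookup f (a \<circ> \<sigma>)"
      if a: "a \<in> ?X" for a
    proof -
      have "x \<circ> inv' \<sigma> = a \<longleftrightarrow> x = a \<circ> \<sigma>" for x
        using permutes_inv_o[OF \<sigma>] by (metis comp_assoc comp_id)
      then have "Poly_Mapping.lookup (perm_act point_act \<sigma> f) a =
          (\<Sum>x\<in>?X. if x = a \<circ> \<sigma> then Poly_Mapping.lookup f x else 0)"
        using f by (subst lookup_perm_act[OF finite_zeros]) (auto simp: point_act_def)
      also have "\<dots> = Poly_Mapping.lookup f (a \<circ> \<sigma>)"
        using finite_zeros zeros_comp_permutes[OF n \<sigma> a] by simp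
      finally show ?thesis .
    qed
    show ?thesis
    proof (intro equalityI subsetI)
      fix q assume q: "q \<in> T (perm_act point_act \<sigma> f)"
      then have qR: "q \<in> carrier R" by (simp add: T_def)
      let ?p = "poly_act (inv' \<sigma>) q"
      have "eval a ?p = Poly_Mapping.lookup f a" if a: "a \<in> ?X" for a
      proof -
        have a': "a \<circ> inv' \<sigma> \<in> ?X" by (rule zeros_comp_permutes[OF n permutes_inv[OF \<sigma>] a])
        then have "eval a ?p = Poly_Mapping.lookup f (a \<circ> inv' \<sigma> \<circ> \<sigma>)"
          using q lookup[OF a'] by (simp add: eval_poly_act[OF bij_imp_bij_inv[OF bij]] T_def)
        then show ?thesis using permutes_inv_o(2)[OF \<sigma>] by (simp add: comp_assoc)
      qed
      then have "?p \<in> T f" using poly_act_closed[OF permutes_inv[OF \<sigma>] qR] by (simp add: T_def)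
      then show "q \<in> quot_act \<sigma> (T f)"
        unfolding quot_act_def using poly_act_inv[OF bij, of q] by (metis imageI)
    next
      fix q assume "q \<in> quot_act \<sigma> (T f)"
      then obtain p where p: "p \<in> T f" "q = poly_act \<sigma> p" by (auto simp: quot_act_def)
      then show "q \<in> T (perm_act point_act \<sigma> f)"
        using poly_act_closed[OF \<sigma>, of p F] zeros_comp_permutes[OF n \<sigma>, of _ F]
        by (auto simp: T_def eval_poly_act[OF bij] lookup)
    qed
  qed
  ultimately show ?thesis unfolding rep_iso_def by blast
qed

section \<open>The zeros as a set with an action of the symmetric group\<close>

lemma sign_point_permute:
  assumes "\<sigma> permutes {1..n}" "A \<subseteq> {1..n}"
  shows "point_act \<sigma> (sign_point n t A) = sign_point n t (\<sigma> ` A)"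
proof
  fix i
  have "inv' \<sigma> i \<in> A \<longleftrightarrow> i \<in> \<sigma> ` A"
    using permutes_inverses[OF assms(1)] by (metis imageE imageI)
  then show "point_act \<sigma> (sign_point n t A) i = sign_point n t (\<sigma> ` A) i"
    using permutes_in_image[OF permutes_inv[OF assms(1)], of i] permutes_not_in[OF permutes_inv[OF assms(1)], of i]
    by (auto simp: point_act_def sign_point_def)
qed

text \<open>
  With \<open>k = (n-2)/2\<close>, the condition \<open>r(s)\<^bsup>n-2\<^esup> = (-1)\<^bsup>|A|\<^esup>\<close> reads \<open>s\<^sup>k = (-1)\<^bsup>|A|\<^esup>\<close> for every choice of
  the square root \<open>r\<close>.  Dividing \<open>s\<close> by a \<open>k\<close>-th root \<open>\<theta>\<close> of \<open>-1\<close> when \<open>|A|\<close> is odd makes it \<open>u\<^sup>k = 1\<close>.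
  The parameter \<open>t\<close> of the sign point depends on \<open>A\<close> only through \<open>|A|\<close>, which permutations preserve.
\<close>

lemma nonzero_zeros_even:
  fixes F :: "'a::{alg_closed_field, field_char_0} itself"
  assumes n: "n \<ge> 3" "even n"
  defines "K \<equiv> {u :: 'a. u ^ ((n - 2) div 2) = 1}"
  shows "\<exists>t. bij_betw (\<lambda>(u, A). sign_point n (t u (card A)) A) (K \<times> Pow {1..n})
    (zeros n (I_gens F n) - {\<lambda>i\<in>{1..n}. 0})"
proof -
  define k where "k = (n - 2) div 2"
  have k: "k > 0" "n - 2 = 2 * k" using n unfolding k_def by presburger+
  have "\<exists>r. \<forall>s :: 'a. r s ^ 2 = s" by (intro choice allI nth_root_exists) simp
  then obtain r :: "'a \<Rightarrow> 'a" where r: "\<And>s. r s ^ 2 = s" by blast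
  obtain \<theta> :: 'a where \<theta>: "\<theta> ^ k = - 1" using nth_root_exists[OF k(1), of "- 1"] by blast
  have \<theta>0: "\<theta> \<noteq> 0" using \<theta> k(1) by (auto simp: power_0_left)
  define c where "c m = (if even m then 1 else \<theta>)" for m :: nat
  have c: "c m \<noteq> 0" "c m ^ k = (- 1) ^ m" for m using \<theta> \<theta>0 by (auto simp: c_def)
  have rk: "r s ^ (n - 2) = s ^ k" for s unfolding k(2) power_mult r ..
  define D where "D = {(s, A). s \<noteq> 0 \<and> A \<subseteq> {1..n} \<and> r s ^ (n - 2) = (- 1) ^ card A}"
  have "bij_betw (\<lambda>(u, A). (u * c (card A), A)) (K \<times> Pow {1..n}) D"
  proof (rule bij_betw_byWitness[where f' = "\<lambda>(s, A). (s / c (card A), A)"])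
    have "u \<noteq> 0" if "u \<in> K" for u
      using that k(1) by (auto simp: K_def k_def[symmetric] power_0_left)
    moreover have "r (u * c m) ^ (n - 2) = (- 1) ^ m" if "u \<in> K" for u m
      using that by (simp add: rk power_mult_distrib c K_def k_def[symmetric])
    ultimately show "(\<lambda>(u, A). (u * c (card A), A)) ` (K \<times> Pow {1..n}) \<subseteq> D"
      using c(1) by (auto simp: D_def)
    have "s / c m \<in> K" if "r s ^ (n - 2) = (- 1) ^ m" for s m
      using that by (simp add: K_def k_def[symmetric] power_divide c rk)
    then show "(\<lambda>(s, A). (s / c (card A), A)) ` D \<subseteq> K \<times> Pow {1..n}"
      by (auto simp: D_def)
  qed (simp_all add: case_prod_unfold c(1))
  from bij_betw_trans[OF this nonzero_zeros_I_gens[OF n(1) r, of F, folded D_def]]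
  have "bij_betw (\<lambda>(u, A). sign_point n (r (u * c (card A))) A) (K \<times> Pow {1..n})
      (zeros n (I_gens F n) - {\<lambda>i\<in>{1..n}. 0})"
    by (simp add: comp_def case_prod_unfold)
  then show ?thesis by (intro exI[of _ "\<lambda>u m. r (u * c m)"])
qed

text \<open>
  The condition \<open>r(s)\<^bsup>n-2\<^esup> = \<plusminus>1\<close> implies \<open>s\<^bsup>n-2\<^esup> = 1\<close>.  For such \<open>s\<close>, as \<open>n - 1\<close> is even, \<open>s\<^bsup>(n-1)/2\<^esup>\<close>
  is a square root of \<open>s\<close>; choosing it makes \<open>r(s)\<^bsup>n-2\<^esup> = 1\<close>, so \<open>|A|\<close> must be even.
\<close>

lemma nonzero_zeros_odd:
  fixes F :: "'a::{alg_closed_field, field_char_0} itself"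
  assumes n: "n \<ge> 3" "odd n"
  defines "K \<equiv> {u :: 'a. u ^ (n - 2) = 1}"
  shows "\<exists>t. bij_betw (\<lambda>(u, A). sign_point n (t u (card A)) A) (K \<times> even_subsets n)
    (zeros n (I_gens F n) - {\<lambda>i\<in>{1..n}. 0})"
proof -
  have "\<exists>r. \<forall>s :: 'a. r s ^ 2 = s" by (intro choice allI nth_root_exists) simp
  then obtain r0 :: "'a \<Rightarrow> 'a" where r0: "\<And>s. r0 s ^ 2 = s" by blast
  \<comment> \<open>Elsewhere any square root will do, since the condition already forces \<open>s \<in> K\<close>.\<close>
  define r where "r s = (if s \<in> K then s ^ ((n - 1) div 2) else r0 s)" for s
  have r: "r s ^ 2 = s" for s
  proof (cases "s \<in> K")
    case True
    have "(n - 1) div 2 * 2 = Suc (n - 2)" using n by auto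
    then have "r s ^ 2 = s * s ^ (n - 2)" using True by (simp add: r_def flip: power_mult)
    then show ?thesis using True by (simp add: K_def)
  qed (simp add: r_def r0)
  have rK: "r s ^ (n - 2) = 1" if "s \<in> K" for s
  proof -
    have "r s ^ (n - 2) = (s ^ (n - 2)) ^ ((n - 1) div 2)"
      using that by (simp add: r_def mult.commute flip: power_mult)
    then show ?thesis using that by (simp add: K_def)
  qed
  have K: "s \<in> K" if "r s ^ (n - 2) = (- 1) ^ m" for s m
  proof -
    have "s ^ (n - 2) = (r s ^ (n - 2)) ^ 2" by (metis r power_mult mult.commute)
    also have "\<dots> = 1" unfolding that by (simp flip: power_mult)
    finally show ?thesis by (simp add: K_def)
  qed
  define D where "D = {(s, A). s \<noteq> 0 \<and> A \<subseteq> {1..n} \<and> r s ^ (n - 2) = (- 1) ^ card A}"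
  have "D = K \<times> even_subsets n"
  proof (intro equalityI subsetI; clarify)
    fix s A assume D: "(s, A) \<in> D"
    then have s: "s \<in> K" using K by (auto simp: D_def)
    moreover have "even (card A)"
      using rK[OF s] D by (auto simp: D_def minus_one_power_iff split: if_splits)
    ultimately show "s \<in> K \<and> A \<in> even_subsets n" using D by (auto simp: D_def even_subsets_def)
  next
    fix s A assume "s \<in> K" "A \<in> even_subsets n"
    then show "(s, A) \<in> D"
      using rK[of s] n by (auto simp: D_def even_subsets_def K_def power_0_left)
  qed
  with nonzero_zeros_I_gens[OF n(1) r, of F, folded D_def]
  show ?thesis by (intro exI[of _ "\<lambda>u m. r u"]) simp
qed

text \<open>
  The origin is a fixed point and contributes the unit element; on the other zeros the group moves only the set of
  negative signs.
\<close>

lemma perm_class_zeros: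
  fixes F :: "'a::{alg_closed_field, field_char_0} itself" and t :: "'a \<Rightarrow> nat \<Rightarrow> 'a"
  assumes n: "n \<ge> 2" and K: "finite K"
    and \<X>: "\<X> \<subseteq> Pow {1..n}" "\<And>\<sigma> A. \<sigma> permutes {1..n} \<Longrightarrow> A \<in> \<X> \<Longrightarrow> \<sigma> ` A \<in> \<X>"
    and bij: "bij_betw (\<lambda>(u, A). sign_point n (t u (card A)) A) (K \<times> \<X>)
      (zeros n (I_gens F n) - {\<lambda>i\<in>{1..n}. 0})"
  shows "perm_class F (sym_group n) (zeros n (I_gens F n)) point_act =
    \<one>\<^bsub>rep_ring F (sym_group n)\<^esub> \<oplus>\<^bsub>rep_ring F (sym_group n)\<^esub>
      add_pow (rep_ring F (sym_group n)) (card K) (perm_class F (sym_group n) \<X> (`))"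
proof -
  let ?S = "sym_group n" and ?X = "zeros n (I_gens F n)" and ?o = "\<lambda>i\<in>{1..n}. 0 :: 'a"
  obtain Z where "split_ideal F n (I_gens F n) Z" using I_is_split_ideal[OF n, of F] by blast
  then have fin: "finite ?X" by (rule split_ideal.finite_zeros)
  have o: "?o \<in> ?X"
  proof (cases "n = 2")
    case False
    have "(\<Prod>j\<in>{1..n}-{i}. ?o j) = 0" for i
    proof (rule prod_zero)
      show "\<exists>j\<in>{1..n}-{i}. ?o j = 0"
        using n by (intro bexI[of _ "if i = 1 then 2 else 1"]) auto
    qed simp
    then show ?thesis using False n by (subst zeros_I_gens) auto
  qed (simp add: zeros_I_gens_2)
  have origin: "finite_gset ?S {?o} point_act"
    using origin_comp_permutes by (intro finite_gset_point_act) auto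
  have rest: "finite_gset ?S (?X - {?o}) point_act"
  proof (rule finite_gset_point_act)
    fix \<sigma> a assume \<sigma>: "\<sigma> permutes {1..n}" and a: "a \<in> ?X - {?o}"
    have "a = a \<circ> \<sigma> \<circ> inv' \<sigma>" using permutes_inv_o(1)[OF \<sigma>] by (simp add: comp_assoc)
    then have "a \<circ> \<sigma> \<noteq> ?o" using a origin_comp_permutes[OF permutes_inv[OF \<sigma>]] by (metis DiffE singletonI)
    then show "a \<circ> \<sigma> \<in> ?X - {?o}" using zeros_comp_permutes[OF n \<sigma>] a by blast
  qed (use fin in simp)
  have subsets: "finite_gset ?S \<X> (`)" by (rule finite_gset_subsets[OF \<X>])
  have "perm_class F ?S ?X point_act = perm_class F ?S ({?o} \<union> (?X - {?o})) point_act"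
    using o by (simp add: insert_absorb)
  also have "\<dots> = \<one>\<^bsub>rep_ring F ?S\<^esub> \<oplus>\<^bsub>rep_ring F ?S\<^esub> perm_class F ?S (?X - {?o}) point_act"
    by (subst perm_class_disjoint_union[OF origin rest]) (simp_all add: perm_class_fixed_point[OF origin])
  also have "perm_class F ?S (?X - {?o}) point_act = perm_class F ?S (K \<times> \<X>) (\<lambda>g (k, A). (k, g ` A))"
  proof (rule perm_class_cong_bij[OF finite_gset_times[OF subsets K] rest bij, symmetric])
    fix \<sigma> x assume \<sigma>: "\<sigma> \<in> carrier ?S" and x: "x \<in> K \<times> \<X>"
    then obtain u A where [simp]: "x = (u, A)" and A: "A \<subseteq> {1..n}" using \<X>(1) by auto
    have "card (\<sigma> ` A) = card A"
      using \<sigma> by (intro card_image) (auto simp: sym_group_carrier intro: inj_on_subset[OF permutes_inj])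
    then show "(\<lambda>(u, A). sign_point n (t u (card A)) A) (case x of (k, A) \<Rightarrow> (k, \<sigma> ` A)) =
        point_act \<sigma> ((\<lambda>(u, A). sign_point n (t u (card A)) A) x)"
      using \<sigma> A by (simp add: sign_point_permute sym_group_carrier)
  qed
  also have "\<dots> = add_pow (rep_ring F ?S) (card K) (perm_class F ?S \<X> (`))"
    by (rule perm_class_times[OF subsets K])
  finally show ?thesis .
qed

theorem theorem2p2:
  fixes F :: "'a::{alg_closed_field, field_char_0} itself" and n :: nat
  assumes "n \<ge> 2"
  shows "let S = sym_group n; Rep = rep_ring F S in
    rep_class S (quot_space F n) quot_act =
      (if even n
       then \<one>\<^bsub>Rep\<^esub> \<oplus>\<^bsub>Rep\<^esub> add_pow Rep ((n - 2) div 2) (perm_class F S (Pow {1..n}) (`))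
       else \<one>\<^bsub>Rep\<^esub> \<oplus>\<^bsub>Rep\<^esub> add_pow Rep (n - 2) (perm_class F S (even_subsets n) (`)))"
proof -
  let ?S = "sym_group n" and ?X = "zeros n (I_gens F n)"
  let ?Rep = "rep_ring F ?S"
  obtain Z where "split_ideal F n (I_gens F n) Z" using I_is_split_ideal[OF assms, of F] by blast
  then have "finite ?X" by (rule split_ideal.finite_zeros)
  then have X: "finite_gset ?S ?X point_act"
    using zeros_comp_permutes[OF assms] by (rule finite_gset_point_act)
  have quot: "rep_class ?S (quot_space F n) quot_act = perm_class F ?S ?X point_act"
    unfolding perm_class_def
    by (rule rep_class_cong_iso[OF perm_space_zeros_iso_quot_space[OF assms], symmetric])
       (rule finite_gset.perm_act_closed[OF X])
  have Pow: "\<sigma> ` A \<in> Pow {1..n}" if "\<sigma> permutes {1..n}" "A \<in> Pow {1..n}" for \<sigma> A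
    using that permutes_image[OF that(1)] by blast
  have even: "\<sigma> ` A \<in> even_subsets n" if "\<sigma> permutes {1..n}" "A \<in> even_subsets n" for \<sigma> A
  proof -
    have "card (\<sigma> ` A) = card A"
      using that(1) by (intro card_image) (auto intro: inj_on_subset[OF permutes_inj])
    then show ?thesis using that(2) Pow[OF that(1), of A] by (auto simp: even_subsets_def)
  qed
  show ?thesis
  proof (cases "n = 2")
    case True
    \<comment> \<open>The only zero is the origin, so the index set of the copies is empty.\<close>
    have "perm_class F ?S ?X point_act =
        \<one>\<^bsub>?Rep\<^esub> \<oplus>\<^bsub>?Rep\<^esub> add_pow ?Rep (card ({} :: 'a set)) (perm_class F ?S (Pow {1..n}) (`))"
      using Pow True by (intro perm_class_zeros[OF assms, where t = "\<lambda>_ _. 0"]) (auto simp: zeros_I_gens_2 bij_betw_def)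
    then show ?thesis using True quot by (simp add: Let_def)
  next
    case False
    then have n: "n \<ge> 3" using assms by simp
    show ?thesis
    proof (cases "even n")
      case True
      let ?K = "{u :: 'a. u ^ ((n - 2) div 2) = 1}"
      have k: "(n - 2) div 2 > 0" using n True by presburger
      have card: "card ?K = (n - 2) div 2" by (rule card_roots_of_unity_alg_closed[OF k])
      then have fin: "finite ?K" using k by (metis card.infinite less_irrefl)
      obtain t where "bij_betw (\<lambda>(u, A). sign_point n (t u (card A)) A) (?K \<times> Pow {1..n}) (?X - {\<lambda>i\<in>{1..n}. 0})"
        using nonzero_zeros_even[OF n True, of F] by blast
      from perm_class_zeros[OF assms fin _ Pow this] show ?thesis
        using True quot by (simp add: Let_def card)
    next
      case odd: False
      let ?K = "{u :: 'a. u ^ (n - 2) = 1}"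
      have k: "n - 2 > 0" using n by simp
      have card: "card ?K = n - 2" by (rule card_roots_of_unity_alg_closed[OF k])
      then have fin: "finite ?K" using k by (metis card.infinite less_irrefl)
      have sub: "even_subsets n \<subseteq> Pow {1..n}" by (auto simp: even_subsets_def)
      obtain t where "bij_betw (\<lambda>(u, A). sign_point n (t u (card A)) A) (?K \<times> even_subsets n) (?X - {\<lambda>i\<in>{1..n}. 0})"
        using nonzero_zeros_odd[OF n odd, of F] by blast
      from perm_class_zeros[OF assms fin sub even this] show ?thesis
        using odd quot by (simp add: Let_def card)
    qed
  qed
qed

end
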